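(* Fix $r\ge0$ and let $f$ be a probability density on $\mathbb{R}$ that belongs to $\mathrm{ALip}(r)$. Assume that $\int_{\mathbb{R}}x^2f(x)\,dx=1$ and that $\int_{\mathbb{R}}|x|^{2+\delta}f(x)\,dx<\infty$ for some $\delta\in(0,2]$. Then there exists a constant $C_0$ independent of $N$ such that, for all $k\le N$, $$\big\|\Pi_k\hat f^N-f^{\otimes k}\big\|_{L^1(\mathbb{R}^k)}\le C_0N^{-\eta},$$ where $\eta$ is given by $$\eta=\frac{\delta}{k+5+\delta+r(2+\delta)}.$$
   Context: Almost Lipschitz spaces: for $r\ge0$ and $0<L_0<\infty$, $\mathrm{ALip}(r,L_0)$ is the set of $f\in L^1(\mathbb{R})$ such that for every $\epsilon>0$ there exists a Lipschitz function $g_\epsilon\in L^1(\mathbb{R})$ with $\|f-g_\epsilon\|_{L^1}\le\epsilon$ and $\|g_\epsilon\|_{\mathrm{Lip}}\le L_0\epsilon^{-r}$, where $\|\cdot\|_{\mathrm{Lip}}$ is the best Lipschitz constant. Further, $\mathrm{ALip}(r)=\bigcup_{0<L_0<\infty}\mathrm{ALip}(r,L_0)$. Kac's sphere is $S^{N-1}=\{x\in\mathbb{R}^N:\sum_i x_i^2=N\}$. For $x\in\mathbb{R}^N\setminus\{0\}$ put $\hat x=\frac{\sqrt N}{|x|}x\in S^{N-1}$. $\hat f^N$ is the push-forward of $f^{\otimes N}$ under $x\mapsto\hat x$ (a probability measure on $S^{N-1}\subset\mathbb{R}^N$). $\Pi_k\hat f^N$ is the marginal of $\hat f^N$ on its first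 $k$ coordinates. The $L^1(\mathbb{R}^k)$ norm of a difference of measures is the total variation norm (total mass of the absolute value of the signed measure), which is the $L^1$ norm of the difference of densities when both are absolutely continuous. *)

theory Defs
  imports "HOL-Probability.Probability"
begin

definition prob_density :: "(real \<Rightarrow> real) \<Rightarrow> bool" where
  "prob_density f \<longleftrightarrow>
     integrable lborel f \<and> (AE x in lborel. 0 \<le> f x) \<and> (\<integral>x. f x \<partial>lborel) = 1"

(* Only meaningful for Lipschitz g: the infimum of the empty set is unspecified. *)
definition best_lipschitz :: "(real \<Rightarrow> real) \<Rightarrow> real" where
  "best_lipschitz g = Inf {C. C-lipschitz_on UNIV g}"

definition ALip_const :: "real \<Rightarrow> real \<Rightarrow> (real \<Rightarrow> real) set" where
  "ALip_const r L0 =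
     {f. integrable lborel f \<and>
         (\<forall>\<epsilon>>0. \<exists>g. integrable lborel g \<and> (\<exists>C. C-lipschitz_on UNIV g) \<and>
            (\<integral>x. \<bar>f x - g x\<bar> \<partial>lborel) \<le> \<epsilon> \<and>
            best_lipschitz g \<le> L0 * \<epsilon> powr (- r))}"

definition ALip :: "real \<Rightarrow> (real \<Rightarrow> real) set" where
  "ALip r = (\<Union>L0\<in>{0<..}. ALip_const r L0)"

(* Points of R^n are functions extensional on {..<n}, i.e. elements of the space of
   PiM {..<n} (\<lambda>_. borel); coordinates are numbered 0, ..., n - 1. *)

definition tensor_power :: "nat \<Rightarrow> (real \<Rightarrow> real) \<Rightarrow> (nat \<Rightarrow> real) measure" where
  "tensor_power n f = (\<Pi>\<^sub>M i\<in>{..<n}. density lborel f)"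

(* At the origin, where the projection is undefined, division by zero yields the origin. *)
definition sphere_proj :: "nat \<Rightarrow> (nat \<Rightarrow> real) \<Rightarrow> (nat \<Rightarrow> real)" where
  "sphere_proj n x = (\<lambda>i\<in>{..<n}. sqrt (real n) / sqrt (\<Sum>j<n. (x j)\<^sup>2) * x i)"

definition rescaled_power :: "nat \<Rightarrow> (real \<Rightarrow> real) \<Rightarrow> (nat \<Rightarrow> real) measure" where
  "rescaled_power n f = distr (tensor_power n f) (\<Pi>\<^sub>M i\<in>{..<n}. borel) (sphere_proj n)"

definition marginal :: "nat \<Rightarrow> (nat \<Rightarrow> real) measure \<Rightarrow> (nat \<Rightarrow> real) measure" where
  "marginal k M = distr M (\<Pi>\<^sub>M i\<in>{..<k}. borel) (\<lambda>x. restrict x {..<k})"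

(* Total mass of the absolute value of the signed measure M - N, for finite measures M and N
   on the same sigma-algebra: the supremum of its variation over finite measurable partitions. *)
definition tv_norm_diff :: "'a measure \<Rightarrow> 'a measure \<Rightarrow> ennreal" where
  "tv_norm_diff M N =
     (SUP P \<in> {P. finite P \<and> partition_on (space M) P \<and> P \<subseteq> sets M}.
        \<Sum>A\<in>P. ennreal \<bar>measure M A - measure N A\<bar>)"

end

(* Let \<mu> be the law with density f and X a sample of size N. Replacing the first k coordinates of
   the rescaled vector by the unscaled ones, one at a time, only ever compares \<mu> with its image under
   a map u \<mapsto> \<rho> u / sqrt (u^2 + q), where \<rho> and q depend on the other coordinates only; so no
   k-dimensional change of variables is needed. The von Bahr--Esseen inequality shows that \<rho>^2 / q
   is close to 1 with high probability. On that event the one-dimensional total variation distance is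
   estimated by replacing f with a Lipschitz function, truncating, and substituting. Balancing the
   errors gives C k^2 N^(-\<eta>_1), with \<eta>_1 the exponent for k = 1. As the exponent for k \<ge> 2 is smaller
   than \<eta>_1 by a fixed amount, this implies the claim while k is at most a small power of N; for
   larger k the claimed bound is at least a positive constant. *)

theory Submission
  imports Defs
begin

text \<open>Total variation compares densities and does not reward moving mass only a short
  distance. A map close to the identity changes the law little only at a rate set by the regularity
  of \<open>f\<close>, and membership in \<open>ALip r\<close> supplies that rate. With all
  coordinates but one held fixed, two consecutive intermediate vectors are one and the same function
  of the remaining coordinate, evaluated at its rescaled and at its original value
  (\<open>hybrid_update\<close>). A common function cannot increase total variation; this is why the
  one-dimensional estimate must hold uniformly over all Borel sets. The factor k^2 arises because
  each of the k replacements pays a probability of order k / N that the coordinates before the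
  current one already use up too much of the squared radius N.\<close>

section \<open>Power inequalities and moments of sums of centred independent variables\<close>

lemma powr_add_le_add_powr:
  fixes a b \<alpha> :: real
  assumes "0 \<le> a" "0 \<le> b" "0 < \<alpha>" "\<alpha> \<le> 1"
  shows "(a + b) powr \<alpha> \<le> a powr \<alpha> + b powr \<alpha>"
proof (cases "a = 0 \<or> b = 0")
  case False
  then have pos: "0 < a" "0 < b" using assms by auto
  \<comment> \<open>The exponent \<alpha> - 1 is nonpositive, so a larger base gives a smaller
    power. Adding the cases c = a and c = b gives the claim.\<close>
  have *: "c * (a + b) powr (\<alpha> - 1) \<le> c powr \<alpha>" if "0 < c" "c \<le> a + b" for c
  proof -
    have "(a + b) powr (\<alpha> - 1) \<le> c powr (\<alpha> - 1)"
      using that assms by (intro powr_mono2') auto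
    then have "c * (a + b) powr (\<alpha> - 1) \<le> c * c powr (\<alpha> - 1)"
      using that by (intro mult_left_mono) auto
    also have "\<dots> = c powr \<alpha>" using that by (simp add: powr_mult_base)
    finally show ?thesis .
  qed
  have "(a + b) powr \<alpha> = (a + b) * (a + b) powr (\<alpha> - 1)"
    using pos by (simp add: powr_mult_base)
  also have "\<dots> \<le> a powr \<alpha> + b powr \<alpha>"
    using *[of a] *[of b] pos by (simp add: distrib_right)
  finally show ?thesis .
qed (use assms in auto)

text \<open>Subadditivity, applied to the larger number as the sum of the smaller one and the
  difference. It serves below with \<alpha> = p - 1, as Hoelder continuity of the derivative of z
  powr p.\<close>

lemma abs_powr_diff_le:
  fixes a b \<alpha> :: real
  assumes "0 \<le> a" "0 \<le> b" "0 < \<alpha>" "\<alpha> \<le> 1"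
  shows "\<bar>a powr \<alpha> - b powr \<alpha>\<bar> \<le> \<bar>a - b\<bar> powr \<alpha>"
proof -
  have "u powr \<alpha> - v powr \<alpha> \<le> \<bar>u - v\<bar> powr \<alpha> \<and> v powr \<alpha> \<le> u powr \<alpha>"
    if "0 \<le> v" "v \<le> u" for u v
    using powr_add_le_add_powr[of "u - v" v \<alpha>] powr_mono2[of \<alpha> v u] that assms by auto
  from this[of a b] this[of b a] show ?thesis
    using assms by (cases "a \<le> b") (auto simp: abs_minus_commute)
qed

text \<open>A second-order expansion would bring in powers with exponent p - 2, which are singular
  at 0 when p < 2. The mean value theorem together with Hoelder continuity of the first derivative
  leaves a remainder in |y| powr p alone. The condition |y| < s keeps the segment from s to s + y in
  the positive half-line.\<close>

lemma abs_powr_Taylor_pos: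
  fixes s y p :: real
  assumes p: "1 < p" "p \<le> 2" and s: "0 < s" and y: "\<bar>y\<bar> < s"
  shows "\<bar>s + y\<bar> powr p \<le> s powr p + p * s powr (p - 1) * y + 2 * \<bar>y\<bar> powr p"
proof (cases "y = 0")
  case False
  have d: "((\<lambda>z. z powr p) has_real_derivative p * z powr (p - 1)) (at z)" if "0 < z" for z
    using that by (rule has_real_derivative_powr)
  have "\<exists>\<xi>. 0 < \<xi> \<and> \<bar>\<xi> - s\<bar> \<le> \<bar>y\<bar> \<and> (s + y) powr p - s powr p = y * (p * \<xi> powr (p - 1))"
  proof (cases "0 < y")
    case True
    from MVT2[of s "s + y" "\<lambda>z. z powr p" "\<lambda>z. p * z powr (p - 1)"] d s True
    obtain z where "s < z" "z < s + y" "(s + y) powr p - s powr p = (s + y - s) * (p * z powr (p - 1))"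
      by auto
    then show ?thesis using s by (intro exI[of _ z]) auto
  next
    case ny: False
    from MVT2[of "s + y" s "\<lambda>z. z powr p" "\<lambda>z. p * z powr (p - 1)"] d s y ny False
    obtain z where "s + y < z" "z < s" "s powr p - (s + y) powr p = (s - (s + y)) * (p * z powr (p - 1))"
      by auto
    then show ?thesis using s y by (intro exI[of _ z]) (auto simp: algebra_simps)
  qed
  then obtain \<xi> where \<xi>: "0 < \<xi>" "\<bar>\<xi> - s\<bar> \<le> \<bar>y\<bar>"
    and eq: "(s + y) powr p - s powr p = y * (p * \<xi> powr (p - 1))" by blast
  have "\<bar>\<xi> powr (p - 1) - s powr (p - 1)\<bar> \<le> \<bar>\<xi> - s\<bar> powr (p - 1)"
    using \<xi> s p by (intro abs_powr_diff_le) auto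
  also have "\<dots> \<le> \<bar>y\<bar> powr (p - 1)" using \<xi> p by (intro powr_mono2) auto
  finally have h: "\<bar>\<xi> powr (p - 1) - s powr (p - 1)\<bar> \<le> \<bar>y\<bar> powr (p - 1)" .
  have "y * (p * \<xi> powr (p - 1)) - p * s powr (p - 1) * y
        = p * (y * (\<xi> powr (p - 1) - s powr (p - 1)))" by (simp add: algebra_simps)
  also have "\<dots> \<le> p * (\<bar>y\<bar> * \<bar>y\<bar> powr (p - 1))"
  proof (intro mult_left_mono)
    have "y * (\<xi> powr (p - 1) - s powr (p - 1)) \<le> \<bar>y\<bar> * \<bar>\<xi> powr (p - 1) - s powr (p - 1)\<bar>"
      by (metis abs_ge_self abs_mult)
    also have "\<dots> \<le> \<bar>y\<bar> * \<bar>y\<bar> powr (p - 1)" using h by (intro mult_left_mono) auto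
    finally show "y * (\<xi> powr (p - 1) - s powr (p - 1)) \<le> \<bar>y\<bar> * \<bar>y\<bar> powr (p - 1)" .
  qed (use p in auto)
  also have "\<dots> = p * \<bar>y\<bar> powr p" by (simp add: powr_mult_base)
  also have "\<dots> \<le> 2 * \<bar>y\<bar> powr p" using p by (intro mult_right_mono) auto
  finally show ?thesis using eq y by (auto simp: abs_if split: if_splits)
qed (use s in auto)

lemma abs_powr_Taylor:
  fixes s y p :: real
  assumes p: "1 < p" "p \<le> 2"
  shows "\<bar>s + y\<bar> powr p \<le> \<bar>s\<bar> powr p + p * sgn s * \<bar>s\<bar> powr (p - 1) * y + 6 * \<bar>y\<bar> powr p"
proof (cases "\<bar>y\<bar> < \<bar>s\<bar>")
  case True
  then consider "0 < s" | "s < 0" by fastforce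
  then show ?thesis
  proof cases
    case 1
    have "\<bar>s + y\<bar> powr p \<le> \<bar>s\<bar> powr p + p * sgn s * \<bar>s\<bar> powr (p - 1) * y + 2 * \<bar>y\<bar> powr p"
      using abs_powr_Taylor_pos[OF p 1, of y] True 1 by simp
    then show ?thesis using powr_ge_zero[of "\<bar>y\<bar>" p] by linarith
  next
    case 2
    have "\<bar>- s + - y\<bar> = \<bar>s + y\<bar>" by linarith
    then have "\<bar>s + y\<bar> powr p \<le> \<bar>s\<bar> powr p + p * sgn s * \<bar>s\<bar> powr (p - 1) * y + 2 * \<bar>y\<bar> powr p"
      using abs_powr_Taylor_pos[OF p, of "-s" "-y"] True 2 by simp
    then show ?thesis using powr_ge_zero[of "\<bar>y\<bar>" p] by linarith
  qed
next
  case False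
  have "\<bar>s + y\<bar> powr p \<le> (2 * \<bar>y\<bar>) powr p" using False p by (intro powr_mono2) auto
  also have "\<dots> = 2 powr p * \<bar>y\<bar> powr p" by (simp add: powr_mult)
  also have "\<dots> \<le> 2 powr 2 * \<bar>y\<bar> powr p" using p by (intro mult_right_mono powr_mono) auto
  finally have 1: "\<bar>s + y\<bar> powr p \<le> 4 * \<bar>y\<bar> powr p" by simp
  have "\<bar>p * sgn s * \<bar>s\<bar> powr (p - 1) * y\<bar> = \<bar>sgn s\<bar> * (p * \<bar>s\<bar> powr (p - 1) * \<bar>y\<bar>)"
    using p by (simp add: abs_mult)
  also have "\<dots> \<le> 1 * (2 * \<bar>y\<bar> powr (p - 1) * \<bar>y\<bar>)"
    using p False by (intro mult_mono powr_mono2) (auto simp: abs_sgn_eq)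
  also have "\<dots> = 2 * \<bar>y\<bar> powr p"
    using powr_mult_base[of "\<bar>y\<bar>" "p - 1"] by (simp add: mult.commute)
  finally have 2: "\<bar>p * sgn s * \<bar>s\<bar> powr (p - 1) * y\<bar> \<le> 2 * \<bar>y\<bar> powr p" .
  show ?thesis using 1 2 powr_ge_zero[of "\<bar>s\<bar>" p] by linarith
qed

text \<open>The von Bahr--Esseen inequality.\<close>

lemma nn_integral_PiM_abs_sum_powr_le:
  fixes Y :: "'a \<Rightarrow> real" and M :: "'a measure" and I :: "'i set"
  assumes "prob_space M" and p: "1 < p" "p \<le> 2" and fin: "finite I"
    and Y: "integrable M Y" "(\<integral>y. Y y \<partial>M) = 0"
    and Yp: "integrable M (\<lambda>y. \<bar>Y y\<bar> powr p)"
  shows "(\<integral>\<^sup>+x. ennreal (\<bar>\<Sum>i\<in>I. Y (x i)\<bar> powr p) \<partial>PiM I (\<lambda>_. M))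
     \<le> ennreal (6 * real (card I) * (\<integral>y. \<bar>Y y\<bar> powr p \<partial>M))"
  using fin
proof (induction I rule: finite_induct)
  case empty
  then show ?case by simp
next
  case (insert i I)
  interpret M: prob_space M by fact
  interpret product_sigma_finite "\<lambda>_::'i. M" by standard
  interpret PP: product_prob_space "\<lambda>_::'i. M" I by standard
  have [measurable]: "Y \<in> borel_measurable M" using Y by auto
  define K where "K = (\<integral>y. \<bar>Y y\<bar> powr p \<partial>M)"
  have K: "0 \<le> K" unfolding K_def by (intro integral_nonneg_AE) auto
  have inner: "(\<integral>\<^sup>+y. ennreal (\<bar>s + Y y\<bar> powr p) \<partial>M) \<le> ennreal (\<bar>s\<bar> powr p) + ennreal (6 * K)" for s
  proof -
    let ?g = "\<lambda>y. \<bar>s\<bar> powr p + p * sgn s * \<bar>s\<bar> powr (p - 1) * Y y + 6 * \<bar>Y y\<bar> powr p"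
    have g: "integrable M ?g" using Y Yp by auto
    have le: "\<bar>s + Y y\<bar> powr p \<le> ?g y" for y by (rule abs_powr_Taylor[OF p])
    then have g0: "0 \<le> ?g y" for y using order_trans[OF powr_ge_zero le] by blast
    have "(\<integral>\<^sup>+y. ennreal (\<bar>s + Y y\<bar> powr p) \<partial>M) \<le> (\<integral>\<^sup>+y. ennreal (?g y) \<partial>M)"
      by (intro nn_integral_mono ennreal_leI le)
    also have "\<dots> = ennreal (\<integral>y. ?g y \<partial>M)"
      using g g0 by (intro nn_integral_eq_integral) auto
    \<comment> \<open>The linear term integrates to 0 because \<open>Y\<close> is centred, so a
      further variable costs at most 6 * K, however large the partial sum s is.\<close>
    also have "(\<integral>y. ?g y \<partial>M) = \<bar>s\<bar> powr p + 6 * K"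
      using Y Yp by (simp add: K_def M.prob_space)
    finally show ?thesis using K by (simp flip: ennreal_plus)
  qed
  have "(\<integral>\<^sup>+x. ennreal (\<bar>\<Sum>j\<in>insert i I. Y (x j)\<bar> powr p) \<partial>PiM (insert i I) (\<lambda>_. M))
      = (\<integral>\<^sup>+x. \<integral>\<^sup>+y. ennreal (\<bar>\<Sum>j\<in>insert i I. Y ((x(i := y)) j)\<bar> powr p) \<partial>M \<partial>PiM I (\<lambda>_. M))"
    using insert by (intro product_nn_integral_insert) auto
  also have "\<dots> = (\<integral>\<^sup>+x. \<integral>\<^sup>+y. ennreal (\<bar>(\<Sum>j\<in>I. Y (x j)) + Y y\<bar> powr p) \<partial>M \<partial>PiM I (\<lambda>_. M))"
  proof (intro nn_integral_cong)
    fix x y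
    have "(\<Sum>j\<in>I. Y ((x(i := y)) j)) = (\<Sum>j\<in>I. Y (x j))"
      using insert by (intro sum.cong) auto
    then show "ennreal (\<bar>\<Sum>j\<in>insert i I. Y ((x(i := y)) j)\<bar> powr p)
       = ennreal (\<bar>(\<Sum>j\<in>I. Y (x j)) + Y y\<bar> powr p)"
      using insert by (simp add: add.commute)
  qed
  also have "\<dots> \<le> (\<integral>\<^sup>+x. ennreal (\<bar>\<Sum>j\<in>I. Y (x j)\<bar> powr p) + ennreal (6 * K) \<partial>PiM I (\<lambda>_. M))"
    by (intro nn_integral_mono inner)
  also have "\<dots> = (\<integral>\<^sup>+x. ennreal (\<bar>\<Sum>j\<in>I. Y (x j)\<bar> powr p) \<partial>PiM I (\<lambda>_. M)) + ennreal (6 * K)"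
    by (subst nn_integral_add) (auto simp: PP.emeasure_space_1)
  also have "\<dots> \<le> ennreal (6 * real (card I) * K) + ennreal (6 * K)"
    using insert.IH by (intro add_mono) (auto simp: K_def)
  also have "\<dots> = ennreal (6 * real (card (insert i I)) * K)"
    using insert K by (simp add: algebra_simps flip: ennreal_plus)
  finally show ?case by (simp add: K_def)
qed

section \<open>The radial rescaling of a single coordinate\<close>

text \<open>In the hybrid argument, one coordinate \<open>u\<close> is replaced by \<open>radial_scale \<rho> q u\<close>, where
  \<open>q\<close> is the squared norm of the later coordinates and \<open>\<rho>\<close> is chosen so that the result has the
  right norm.\<close>

definition radial_scale :: "real \<Rightarrow> real \<Rightarrow> real \<Rightarrow> real" where
  "radial_scale \<rho> q u = \<rho> / sqrt (u\<^sup>2 + q) * u"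

lemma radial_scale_minus: "radial_scale \<rho> q (- u) = - radial_scale \<rho> q u"
  by (simp add: radial_scale_def)

lemma borel_measurable_radial_scale [measurable]:
  "radial_scale \<rho> q \<in> borel_measurable borel"
  unfolding radial_scale_def by measurable

lemma has_real_derivative_radial_scale:
  assumes "0 < q"
  shows "(radial_scale \<rho> q has_real_derivative \<rho> * q / sqrt (u\<^sup>2 + q) ^ 3) (at u)"
proof -
  have pos: "0 < u\<^sup>2 + q" using assms by (simp add: add_nonneg_pos)
  define s where "s = sqrt (u\<^sup>2 + q)"
  have s: "0 < s" "s\<^sup>2 = u\<^sup>2 + q" using pos by (auto simp: s_def)
  have "((\<lambda>u. sqrt (u\<^sup>2 + q)) has_real_derivative u / s) (at u)"
    unfolding s_def
  proof (rule DERIV_cong[OF DERIV_chain2[where f = sqrt and g = "\<lambda>u. u\<^sup>2 + q" and x = u, OF DERIV_real_sqrt[OF pos]]])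
    show "((\<lambda>u. u\<^sup>2 + q) has_real_derivative 2 * u) (at u)"
      by (auto intro!: derivative_eq_intros)
  qed (simp add: inverse_eq_divide)
  then have "((\<lambda>u. \<rho> / sqrt (u\<^sup>2 + q)) has_real_derivative (0 * s - \<rho> * (u / s)) / (s * s)) (at u)"
    unfolding s_def using s(1)[unfolded s_def] by (rule DERIV_divide[OF DERIV_const _ less_imp_neq[THEN not_sym]])
  from DERIV_mult[OF this DERIV_ident]
  have "(radial_scale \<rho> q has_real_derivative (0 * s - \<rho> * (u / s)) / (s * s) * u + 1 * (\<rho> / s)) (at u)"
    unfolding s_def radial_scale_def[abs_def] .
  moreover have "(0 * s - \<rho> * (u / s)) / (s * s) * u + 1 * (\<rho> / s) = \<rho> * (s\<^sup>2 - u\<^sup>2) / s ^ 3"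
    using s(1) by (simp add: field_simps power2_eq_square power3_eq_cube)
  ultimately show ?thesis using s by (simp add: s_def)
qed

text \<open>With a = \<rho> / sqrt q and c = sqrt q / sqrt (u^2 + q), the map multiplies u by a * c
  and its derivative is a * c^3. Both products are within 4 * h of 1, because |a - 1| \<le> 2 * h
  and 1 - 2 * h \<le> c^3 \<le> c \<le> 1.\<close>

lemma radial_scale_bounds:
  assumes h: "0 < h" "h \<le> 1 / 8" and \<rho>: "0 < \<rho>" and q: "0 < q"
    and close: "\<bar>\<rho>\<^sup>2 - q\<bar> \<le> 2 * h * q" and u: "u\<^sup>2 \<le> h * q"
  shows "\<bar>radial_scale \<rho> q u - u\<bar> \<le> 4 * h * \<bar>u\<bar>"
    and "\<bar>1 - \<rho> * q / sqrt (u\<^sup>2 + q) ^ 3\<bar> \<le> 4 * h"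
proof -
  define a where "a = \<rho> / sqrt q"
  define c where "c = sqrt q / sqrt (u\<^sup>2 + q)"
  have pos: "0 < u\<^sup>2 + q" using q by (simp add: add_nonneg_pos)
  have a0: "0 < a" using \<rho> q by (simp add: a_def)
  have "a\<^sup>2 = \<rho>\<^sup>2 / q" using q by (simp add: a_def power_divide)
  then have "a\<^sup>2 - 1 = (\<rho>\<^sup>2 - q) / q" using q by (simp add: field_simps)
  then have "\<bar>a\<^sup>2 - 1\<bar> \<le> 2 * h"
    using close q by (simp add: pos_divide_le_eq)
  moreover have "\<bar>a\<^sup>2 - 1\<bar> = \<bar>a - 1\<bar> * (a + 1)"
  proof -
    have "a\<^sup>2 - 1 = (a - 1) * (a + 1)" by (simp add: algebra_simps power2_eq_square)
    then show ?thesis using a0 by (simp add: abs_mult)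
  qed
  moreover have "\<bar>a - 1\<bar> * 1 \<le> \<bar>a - 1\<bar> * (a + 1)" using a0 by (intro mult_left_mono) auto
  ultimately have a: "\<bar>a - 1\<bar> \<le> 2 * h" by (simp only: mult_1_right)
  have c0: "0 < c" "c \<le> 1" using q pos by (auto simp: c_def)
  have c2: "c\<^sup>2 = q / (u\<^sup>2 + q)" using q pos by (simp add: c_def power_divide)
  have "(1 - h) * (u\<^sup>2 + q) \<le> q"
  proof -
    have "(1 - h) * u\<^sup>2 \<le> 1 * u\<^sup>2" using h by (intro mult_right_mono) auto
    then show ?thesis using u by (simp add: algebra_simps)
  qed
  then have c2h: "1 - h \<le> c\<^sup>2" using pos unfolding c2 by (simp add: pos_le_divide_eq)
  \<comment> \<open>The cube is bounded through c^4, the square of c^2, which is free of square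
    roots; c \<le> 1 gives c^4 \<le> c^3.\<close>
  have "(1 - h)\<^sup>2 \<le> (c\<^sup>2)\<^sup>2" using c2h h by (intro power_mono) auto
  also have "(c\<^sup>2)\<^sup>2 = c ^ 4" by simp
  also have "c ^ 4 \<le> c ^ 3" using c0 by (intro power_decreasing) auto
  finally have "1 - 2 * h + h\<^sup>2 \<le> c ^ 3" by (simp add: power2_eq_square algebra_simps)
  then have c3: "1 - 2 * h \<le> c ^ 3" by (smt (verit) zero_le_power2)
  have c31: "c ^ 3 \<le> c" using c0 power_decreasing[of 1 3 c] by simp
  have up: "a * x \<le> 1 + 4 * h" if "0 < x" "x \<le> 1" for x
  proof -
    have "a * x \<le> a * 1" using that a0 by (intro mult_left_mono) auto
    then show ?thesis using a h by linarith
  qed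
  have low: "1 - 4 * h \<le> a * x" if "1 - 2 * h \<le> x" for x
  proof -
    have "(1 - 2 * h) * (1 - 2 * h) \<le> a * x"
      using that a a0 h by (intro mult_mono) auto
    moreover have "(1 - 2 * h) * (1 - 2 * h) = 1 - 4 * h + 4 * h\<^sup>2"
      by (simp add: algebra_simps power2_eq_square)
    ultimately show ?thesis by (smt (verit) zero_le_power2)
  qed
  have c3pos: "0 < c ^ 3" using c0 by simp
  have rs: "radial_scale \<rho> q u = a * c * u"
    using q by (simp add: radial_scale_def a_def c_def)
  have "radial_scale \<rho> q u - u = (a * c - 1) * u" using rs by (simp add: algebra_simps)
  also have "\<bar>\<dots>\<bar> \<le> 4 * h * \<bar>u\<bar>"
    unfolding abs_mult using up[of c] low[of c] c0 c3 c31 by (intro mult_right_mono) auto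
  finally show "\<bar>radial_scale \<rho> q u - u\<bar> \<le> 4 * h * \<bar>u\<bar>" .
  have "sqrt q ^ 3 = q * sqrt q" using q by (simp add: power3_eq_cube)
  then have "\<rho> * q / sqrt (u\<^sup>2 + q) ^ 3 = a * c ^ 3"
    using q by (simp add: a_def c_def power_divide)
  then show "\<bar>1 - \<rho> * q / sqrt (u\<^sup>2 + q) ^ 3\<bar> \<le> 4 * h"
    using up[of "c ^ 3"] low[of "c ^ 3"] c0 c3 c31 c3pos by (auto simp: abs_le_iff)
qed

text \<open>The first integral is truncated to I = [-R, R], the second to the image J of I, and the
  second is then pulled back to I by substitution. Both integrands now carry the same factor
  \<open>indicator B (\<phi> u)\<close>, so only g and (g o \<phi>) * \<phi>' remain to be compared
  and the bound is independent of \<open>B\<close>.\<close>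

lemma integral_radial_scale_diff_le:
  fixes g :: "real \<Rightarrow> real"
  assumes g: "integrable lborel g" and lip: "L-lipschitz_on UNIV g"
    and h: "0 < h" "h \<le> 1 / 8" and \<rho>: "0 < \<rho>" and q: "0 < q"
    and close: "\<bar>\<rho>\<^sup>2 - q\<bar> \<le> 2 * h * q" and R: "0 < R" "R\<^sup>2 \<le> h * q"
    and B: "B \<in> sets borel"
  shows "\<bar>(\<integral>u. indicator B (radial_scale \<rho> q u) * g u \<partial>lborel) - (\<integral>u. indicator B u * g u \<partial>lborel)\<bar>
    \<le> 2 * (\<integral>u. indicator {u. R / 2 < \<bar>u\<bar>} u * \<bar>g u\<bar> \<partial>lborel)
       + 4 * h * (\<integral>u. \<bar>g u\<bar> \<partial>lborel) + 16 * h * L * R\<^sup>2"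
proof -
  define \<phi> where "\<phi> = radial_scale \<rho> q"
  define \<phi>' where "\<phi>' u = \<rho> * q / sqrt (u\<^sup>2 + q) ^ 3" for u
  define I where "I = {-R..R}"
  define J where "J = {\<phi> (-R)..\<phi> R}"
  define T where "T = {u. R / 2 < \<bar>u\<bar>}"
  note [measurable] = B
  have [measurable]: "\<phi> \<in> borel_measurable borel" by (simp add: \<phi>_def)
  have [measurable]: "g \<in> borel_measurable borel" using g by auto
  have [measurable]: "I \<in> sets borel" "J \<in> sets borel" by (auto simp: I_def J_def)
  have [measurable]: "T \<in> sets borel" unfolding T_def by measurable
  have L: "0 \<le> L" using lip by (rule lipschitz_on_nonneg)
  have sq: "u\<^sup>2 \<le> h * q" if "u \<in> I" for u
    using that R abs_le_square_iff[of u R] by (auto simp: I_def)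
  have \<phi>1: "\<bar>\<phi> u - u\<bar> \<le> 4 * h * \<bar>u\<bar>" if "u \<in> I" for u
    unfolding \<phi>_def by (rule radial_scale_bounds(1)[OF h \<rho> q close sq[OF that]])
  have \<phi>'1: "\<bar>1 - \<phi>' u\<bar> \<le> 4 * h" if "u \<in> I" for u
    unfolding \<phi>'_def by (rule radial_scale_bounds(2)[OF h \<rho> q close sq[OF that]])
  \<comment> \<open>As 4 * h \<le> 1 / 2, the interval J contains [-R / 2, R / 2], so a single tail
    set T serves both truncations.\<close>
  have \<phi>R: "R / 2 \<le> \<phi> R"
  proof -
    have "4 * h * \<bar>R\<bar> \<le> (1/2) * \<bar>R\<bar>" using h by (intro mult_right_mono) auto
    moreover have "\<bar>\<phi> R - R\<bar> \<le> 4 * h * \<bar>R\<bar>" using R by (intro \<phi>1) (auto simp: I_def)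
    ultimately show ?thesis using R by linarith
  qed
  have outJ: "u \<in> T" if "u \<notin> J" for u
    using that \<phi>R by (auto simp: J_def T_def \<phi>_def radial_scale_minus)
  have outI: "u \<in> T" if "u \<notin> I" for u
    using that R by (auto simp: I_def T_def)
  have int_comp: "integrable lborel (\<lambda>u. indicator B (\<phi> u) * g u * indicator X u)"
    if [measurable]: "X \<in> sets borel" for X
    using g by (rule Bochner_Integration.integrable_bound) (auto split: split_indicator)
  have int_B: "integrable lborel (\<lambda>u. indicator B u * g u * indicator X u)"
    if [measurable]: "X \<in> sets borel" for X
    using g by (rule Bochner_Integration.integrable_bound) (auto split: split_indicator)
  have int_T: "integrable lborel (\<lambda>u. indicator T u * \<bar>g u\<bar>)"
    using g by (rule Bochner_Integration.integrable_bound) (auto split: split_indicator)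
  define \<tau> where "\<tau> = (\<integral>u. indicator T u * \<bar>g u\<bar> \<partial>lborel)"

  have tail1: "\<bar>(\<integral>u. indicator B (\<phi> u) * g u \<partial>lborel) - (\<integral>u. indicator B (\<phi> u) * g u * indicator I u \<partial>lborel)\<bar> \<le> \<tau>"
  proof -
    have "(\<integral>u. indicator B (\<phi> u) * g u \<partial>lborel) - (\<integral>u. indicator B (\<phi> u) * g u * indicator I u \<partial>lborel)
       = (\<integral>u. indicator B (\<phi> u) * g u * indicator UNIV u - indicator B (\<phi> u) * g u * indicator I u \<partial>lborel)"
      using int_comp[of UNIV] int_comp[of I] by (subst Bochner_Integration.integral_diff) auto
    also have "\<bar>\<dots>\<bar> \<le> \<tau>"
      unfolding \<tau>_def
    proof (rule order_trans[OF integral_abs_bound], rule integral_mono)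
      show "integrable lborel (\<lambda>u. \<bar>indicator B (\<phi> u) * g u * indicator UNIV u - indicator B (\<phi> u) * g u * indicator I u\<bar>)"
        using int_comp[of UNIV] int_comp[of I] by auto
    qed (use int_T outI in \<open>auto split: split_indicator\<close>)
    finally show ?thesis .
  qed
  have tail2: "\<bar>(\<integral>u. indicator B u * g u \<partial>lborel) - (\<integral>u. indicator B u * g u * indicator J u \<partial>lborel)\<bar> \<le> \<tau>"
  proof -
    have "(\<integral>u. indicator B u * g u \<partial>lborel) - (\<integral>u. indicator B u * g u * indicator J u \<partial>lborel)
       = (\<integral>u. indicator B u * g u * indicator UNIV u - indicator B u * g u * indicator J u \<partial>lborel)"
      using int_B[of UNIV] int_B[of J] by (subst Bochner_Integration.integral_diff) auto
    also have "\<bar>\<dots>\<bar> \<le> \<tau>"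
      unfolding \<tau>_def
    proof (rule order_trans[OF integral_abs_bound], rule integral_mono)
      show "integrable lborel (\<lambda>u. \<bar>indicator B u * g u * indicator UNIV u - indicator B u * g u * indicator J u\<bar>)"
        using int_B[of UNIV] int_B[of J] by auto
    qed (use int_T outJ in \<open>auto split: split_indicator\<close>)
    finally show ?thesis .
  qed

  have set_int: "set_integrable lborel J (\<lambda>u. indicator B u * g u)"
    using int_B[of J] unfolding set_integrable_def by (simp add: mult_ac)
  have der: "(\<phi> has_real_derivative \<phi>' u) (at u)" for u
    unfolding \<phi>_def \<phi>'_def by (rule has_real_derivative_radial_scale[OF q])
  have pos: "0 < u\<^sup>2 + q" for u using q by (simp add: add_nonneg_pos)
  have cont: "continuous_on {-R..R} \<phi>'"
    unfolding \<phi>'_def using pos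
    by (intro continuous_intros) (auto simp: less_imp_neq[THEN not_sym])
  have \<phi>'_nonneg: "0 \<le> \<phi>' u" for u using \<rho> q by (simp add: \<phi>'_def)
  have subst1: "set_integrable lborel I (\<lambda>x. indicator B (\<phi> x) * g (\<phi> x) * \<phi>' x)"
   and subst2: "(\<integral>u. indicator B u * g u * indicator J u \<partial>lborel)
       = (\<integral>u. indicator B (\<phi> u) * g (\<phi> u) * \<phi>' u * indicator I u \<partial>lborel)"
    using integral_substitution[OF set_int[unfolded J_def] der cont \<phi>'_nonneg] R
    by (auto simp: I_def J_def)
  have int_s: "integrable lborel (\<lambda>u. indicator B (\<phi> u) * g (\<phi> u) * \<phi>' u * indicator I u)"
    using subst1 unfolding set_integrable_def by (simp add: mult_ac)
  \<comment> \<open>The error splits into a Jacobian part, g u * (1 - \<phi>' u), and a displacement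
    part, \<phi>' u * (g u - g (\<phi> u)). In the latter \<phi>' \<le> 2 and the displacement is at
    most 4 * h * R, which gives 8 * h * L * R; integrating over the length 2 * R turns this into 16
    * h * L * R^2.\<close>
  have pw: "\<bar>g u - g (\<phi> u) * \<phi>' u\<bar> \<le> 4 * h * \<bar>g u\<bar> + 8 * h * L * R" if u: "u \<in> I" for u
  proof -
    have "g u - g (\<phi> u) * \<phi>' u = g u * (1 - \<phi>' u) + \<phi>' u * (g u - g (\<phi> u))"
      by (simp add: algebra_simps)
    then have "\<bar>g u - g (\<phi> u) * \<phi>' u\<bar> \<le> \<bar>g u\<bar> * \<bar>1 - \<phi>' u\<bar> + \<phi>' u * \<bar>g u - g (\<phi> u)\<bar>"
      using \<phi>'_nonneg[of u] by (metis abs_mult abs_of_nonneg abs_triangle_ineq)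
    also have "\<bar>g u\<bar> * \<bar>1 - \<phi>' u\<bar> \<le> \<bar>g u\<bar> * (4 * h)"
      using \<phi>'1[OF u] by (intro mult_left_mono) auto
    also have "\<phi>' u * \<bar>g u - g (\<phi> u)\<bar> \<le> 2 * (L * (4 * h * R))"
    proof (intro mult_mono)
      show "\<phi>' u \<le> 2" using \<phi>'1[OF u] h by auto
      have "\<bar>g u - g (\<phi> u)\<bar> \<le> L * \<bar>u - \<phi> u\<bar>"
        using lipschitz_onD[OF lip, of u "\<phi> u"] by (simp add: dist_real_def)
      also have "\<bar>u - \<phi> u\<bar> \<le> 4 * h * R"
      proof -
        have "4 * h * \<bar>u\<bar> \<le> 4 * h * R" using u h by (intro mult_left_mono) (auto simp: I_def)
        then show ?thesis using \<phi>1[OF u] by linarith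
      qed
      finally show "\<bar>g u - g (\<phi> u)\<bar> \<le> L * (4 * h * R)"
        using L by (auto intro: mult_left_mono)
    qed auto
    finally show ?thesis by (simp add: algebra_simps)
  qed
  have intI: "integrable lborel (indicator I :: real \<Rightarrow> real)"
    using R by (intro integrable_real_indicator) (auto simp: I_def)
  have main: "\<bar>(\<integral>u. indicator B (\<phi> u) * g u * indicator I u \<partial>lborel)
      - (\<integral>u. indicator B u * g u * indicator J u \<partial>lborel)\<bar> \<le> 4 * h * (\<integral>u. \<bar>g u\<bar> \<partial>lborel) + 16 * h * L * R\<^sup>2"
  proof -
    have eq: "(\<integral>u. indicator B (\<phi> u) * g u * indicator I u \<partial>lborel)
      - (\<integral>u. indicator B u * g u * indicator J u \<partial>lborel)
      = (\<integral>u. indicator B (\<phi> u) * g u * indicator I u - indicator B (\<phi> u) * g (\<phi> u) * \<phi>' u * indicator I u \<partial>lborel)"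
      unfolding subst2 by (rule Bochner_Integration.integral_diff[symmetric, OF int_comp int_s]) simp
    have "\<bar>\<integral>u. indicator B (\<phi> u) * g u * indicator I u - indicator B (\<phi> u) * g (\<phi> u) * \<phi>' u * indicator I u \<partial>lborel\<bar>
      \<le> (\<integral>u. 4 * h * \<bar>g u\<bar> + 8 * h * L * R * indicator I u \<partial>lborel)"
    proof (rule order_trans[OF integral_abs_bound], rule integral_mono)
      show "integrable lborel (\<lambda>u. \<bar>indicator B (\<phi> u) * g u * indicator I u - indicator B (\<phi> u) * g (\<phi> u) * \<phi>' u * indicator I u\<bar>)"
        using int_comp[of I] int_s by auto
      show "integrable lborel (\<lambda>u. 4 * h * \<bar>g u\<bar> + 8 * h * L * R * indicator I u)"
        using g intI by auto
      show "\<bar>indicator B (\<phi> u) * g u * indicator I u - indicator B (\<phi> u) * g (\<phi> u) * \<phi>' u * indicator I u\<bar>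
        \<le> 4 * h * \<bar>g u\<bar> + 8 * h * L * R * indicator I u" for u
        using pw[of u] h by (auto split: split_indicator)
    qed
    also have "\<dots> = 4 * h * (\<integral>u. \<bar>g u\<bar> \<partial>lborel) + 8 * h * L * R * (2 * R)"
    proof -
      have "(\<integral>u. indicator I u \<partial>lborel) = measure lborel I" by simp
      also have "\<dots> = 2 * R" using R by (simp add: I_def)
      finally have "(\<integral>u. indicator I u \<partial>lborel) = 2 * R" .
      moreover have "(\<integral>u. 4 * h * \<bar>g u\<bar> + 8 * h * L * R * indicator I u \<partial>lborel)
        = (\<integral>u. 4 * h * \<bar>g u\<bar> \<partial>lborel) + (\<integral>u. 8 * h * L * R * indicator I u \<partial>lborel)"
        by (rule Bochner_Integration.integral_add)
           (intro integrable_mult_right integrable_abs g intI)+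
      ultimately show ?thesis by simp
    qed
    also have "8 * h * L * R * (2 * R) = 16 * h * L * R\<^sup>2" by (simp add: power2_eq_square)
    finally show ?thesis by (simp only: eq)
  qed
  have "2 * \<tau> = 2 * (\<integral>u. indicator {u. R / 2 < \<bar>u\<bar>} u * \<bar>g u\<bar> \<partial>lborel)"
    by (simp add: \<tau>_def T_def)
  then show ?thesis using tail1 tail2 main unfolding \<phi>_def by linarith
qed

section \<open>Passing from the Lipschitz approximation to the density itself\<close>

lemma measure_density_prob_density:
  assumes "prob_density f" "A \<in> sets borel"
  shows "measure (density lborel f) A = (\<integral>x. indicator A x * f x \<partial>lborel)"
proof -
  have f: "integrable lborel f" "AE x in lborel. 0 \<le> f x"
    using assms(1) by (auto simp: prob_density_def)
  have [measurable]: "f \<in> borel_measurable borel" "A \<in> sets borel" using f assms(2) by auto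
  have int: "integrable lborel (\<lambda>x. indicator A x * f x)"
    using f(1) by (rule Bochner_Integration.integrable_bound) (auto split: split_indicator)
  have nn: "AE x in lborel. 0 \<le> indicator A x * f x"
    using f(2) by eventually_elim (auto split: split_indicator)
  have "emeasure (density lborel f) A = (\<integral>\<^sup>+x. ennreal (f x) * indicator A x \<partial>lborel)"
    by (rule emeasure_density) auto
  also have "\<dots> = (\<integral>\<^sup>+x. ennreal (indicator A x * f x) \<partial>lborel)"
    by (intro nn_integral_cong) (auto split: split_indicator)
  also have "\<dots> = ennreal (\<integral>x. indicator A x * f x \<partial>lborel)"
    using int nn by (rule nn_integral_eq_integral)
  finally show ?thesis
    using nn by (simp add: measure_def integral_nonneg_AE)
qed

lemma prob_space_density_prob_density:
  assumes "prob_density f"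
  shows "prob_space (density lborel f)"
proof
  have f: "integrable lborel f" "AE x in lborel. 0 \<le> f x" "(\<integral>x. f x \<partial>lborel) = 1"
    using assms by (auto simp: prob_density_def)
  have [measurable]: "f \<in> borel_measurable borel" using f by auto
  have "emeasure (density lborel f) UNIV = (\<integral>\<^sup>+x. ennreal (f x) * indicator UNIV x \<partial>lborel)"
    by (rule emeasure_density) auto
  also have "\<dots> = 1" using nn_integral_eq_integral[OF f(1,2)] f(3) by simp
  finally show "emeasure (density lborel f) (space (density lborel f)) = 1" by simp
qed

lemma integral_tail_le_moment:
  assumes f: "prob_density f" and m: "0 < m" and R: "0 < R"
    and mom: "integrable lborel (\<lambda>x. \<bar>x\<bar> powr m * f x)"
  shows "(\<integral>u. indicator {u. R < \<bar>u\<bar>} u * \<bar>f u\<bar> \<partial>lborel) \<le> R powr (- m) * (\<integral>x. \<bar>x\<bar> powr m * f x \<partial>lborel)"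
proof -
  have f': "integrable lborel f" "AE x in lborel. 0 \<le> f x"
    using f by (auto simp: prob_density_def)
  have [measurable]: "f \<in> borel_measurable borel" using f' by auto
  have "(\<integral>u. indicator {u. R < \<bar>u\<bar>} u * \<bar>f u\<bar> \<partial>lborel)
     \<le> (\<integral>x. R powr (- m) * (\<bar>x\<bar> powr m * f x) \<partial>lborel)"
  proof (rule integral_mono_AE)
    show "integrable lborel (\<lambda>u. indicator {u. R < \<bar>u\<bar>} u * \<bar>f u\<bar>)"
      using f'(1) by (rule Bochner_Integration.integrable_bound) (auto split: split_indicator)
    show "AE u in lborel. indicator {u. R < \<bar>u\<bar>} u * \<bar>f u\<bar> \<le> R powr (- m) * (\<bar>u\<bar> powr m * f u)"
      using f'(2)
    proof eventually_elim
      case (elim u)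
      show ?case
      proof (cases "R < \<bar>u\<bar>")
        case True
        then have "R powr m \<le> \<bar>u\<bar> powr m" using R m by (intro powr_mono2) auto
        then have "R powr (- m) * R powr m \<le> R powr (- m) * \<bar>u\<bar> powr m"
          by (intro mult_left_mono) auto
        then have "1 \<le> R powr (- m) * \<bar>u\<bar> powr m"
          using R by (simp flip: powr_add)
        then have "1 * f u \<le> R powr (- m) * \<bar>u\<bar> powr m * f u"
          using elim by (intro mult_right_mono) auto
        then show ?thesis using True elim by (simp add: mult_ac)
      qed (use elim in auto)
    qed
  qed (use mom in auto)
  then show ?thesis by simp
qed

text \<open>Working with \<open>g\<close> costs 4 * \<epsilon>: once for each of the two measures,
  and once for each of the two tails of \<open>g\<close>, which has no moment bound of its own and
  borrows that of \<open>f\<close>. The norm of \<open>g\<close> is at most 1 + \<epsilon> for a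
  similar reason.\<close>

lemma measure_radial_scale_diff_le:
  assumes f: "prob_density f" and m: "0 < m"
    and mom: "integrable lborel (\<lambda>x. \<bar>x\<bar> powr m * f x)"
    and g: "integrable lborel g" and lip: "L-lipschitz_on UNIV g"
    and fg: "(\<integral>x. \<bar>f x - g x\<bar> \<partial>lborel) \<le> \<epsilon>"
    and h: "0 < h" "h \<le> 1 / 8" and \<rho>: "0 < \<rho>" and q: "0 < q"
    and close: "\<bar>\<rho>\<^sup>2 - q\<bar> \<le> 2 * h * q" and R: "0 < R" "R\<^sup>2 \<le> h * q"
    and B: "B \<in> sets borel"
  shows "\<bar>measure (density lborel f) (radial_scale \<rho> q -` B) - measure (density lborel f) B\<bar>
    \<le> 4 * \<epsilon> + 2 * ((R / 2) powr (- m) * (\<integral>x. \<bar>x\<bar> powr m * f x \<partial>lborel))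
       + 4 * h * (1 + \<epsilon>) + 16 * h * L * R\<^sup>2"
proof -
  note [measurable] = B
  have f': "integrable lborel f" "AE x in lborel. 0 \<le> f x" "(\<integral>x. f x \<partial>lborel) = 1"
    using f by (auto simp: prob_density_def)
  have [measurable]: "f \<in> borel_measurable borel" "g \<in> borel_measurable borel" using f' g by auto
  have int_diff: "integrable lborel (\<lambda>x. \<bar>f x - g x\<bar>)" using f' g by auto
  have repl: "\<bar>(\<integral>x. indicator X x * f x \<partial>lborel) - (\<integral>x. indicator X x * g x \<partial>lborel)\<bar> \<le> \<epsilon>"
    if [measurable]: "X \<in> sets borel" for X :: "real set"
  proof -
    have i: "integrable lborel (\<lambda>x. indicator X x * f x)" "integrable lborel (\<lambda>x. indicator X x * g x)"
      by (rule Bochner_Integration.integrable_bound[OF f'(1)] Bochner_Integration.integrable_bound[OF g];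
          auto split: split_indicator)+
    have eq: "(\<integral>x. indicator X x * f x \<partial>lborel) - (\<integral>x. indicator X x * g x \<partial>lborel)
       = (\<integral>x. indicator X x * f x - indicator X x * g x \<partial>lborel)"
      using i by simp
    have "\<bar>\<integral>x. indicator X x * f x - indicator X x * g x \<partial>lborel\<bar> \<le> (\<integral>x. \<bar>f x - g x\<bar> \<partial>lborel)"
    proof (rule order_trans[OF integral_abs_bound], rule integral_mono)
      show "integrable lborel (\<lambda>x. \<bar>indicator X x * f x - indicator X x * g x\<bar>)" using i by auto
    qed (use int_diff in \<open>auto split: split_indicator\<close>)
    then show ?thesis using fg unfolding eq by linarith
  qed
  have norm_g: "(\<integral>u. \<bar>g u\<bar> \<partial>lborel) \<le> 1 + \<epsilon>"
  proof -
    have "(\<integral>u. \<bar>g u\<bar> \<partial>lborel) \<le> (\<integral>u. f u + \<bar>f u - g u\<bar> \<partial>lborel)"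
      using f'(2) by (intro integral_mono_AE) (use g f' int_diff in auto)
    also have "\<dots> = 1 + (\<integral>x. \<bar>f x - g x\<bar> \<partial>lborel)" using f' int_diff by simp
    finally show ?thesis using fg by linarith
  qed
  let ?T = "{u::real. R / 2 < \<bar>u\<bar>}"
  have tail_g: "(\<integral>u. indicator ?T u * \<bar>g u\<bar> \<partial>lborel)
     \<le> \<epsilon> + (R / 2) powr (- m) * (\<integral>x. \<bar>x\<bar> powr m * f x \<partial>lborel)"
  proof -
    have i: "integrable lborel (\<lambda>u. indicator ?T u * \<bar>f u\<bar>)" "integrable lborel (\<lambda>u. indicator ?T u * \<bar>g u\<bar>)"
      by (rule Bochner_Integration.integrable_bound[OF f'(1)] Bochner_Integration.integrable_bound[OF g];
          auto split: split_indicator)+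
    have "(\<integral>u. indicator ?T u * \<bar>g u\<bar> \<partial>lborel) \<le> (\<integral>u. \<bar>f u - g u\<bar> + indicator ?T u * \<bar>f u\<bar> \<partial>lborel)"
      by (intro integral_mono) (use i int_diff in \<open>auto split: split_indicator\<close>)
    also have "\<dots> = (\<integral>u. \<bar>f u - g u\<bar> \<partial>lborel) + (\<integral>u. indicator ?T u * \<bar>f u\<bar> \<partial>lborel)"
      by (rule Bochner_Integration.integral_add[OF int_diff i(1)])
    finally show ?thesis using fg integral_tail_le_moment[OF f m _ mom, of "R / 2"] R by linarith
  qed
  have "4 * h * (\<integral>u. \<bar>g u\<bar> \<partial>lborel) \<le> 4 * h * (1 + \<epsilon>)"
    using norm_g h by (intro mult_left_mono) auto
  moreover have vm: "radial_scale \<rho> q -` B \<in> sets borel"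
    using measurable_sets[OF borel_measurable_radial_scale B] by simp
  moreover have "indicator (radial_scale \<rho> q -` B) u = (indicator B (radial_scale \<rho> q u) :: real)" for u
    by (simp add: indicator_def)
  ultimately show ?thesis
    using integral_radial_scale_diff_le[OF g lip h \<rho> q close R B] tail_g
      repl[OF vm] repl[OF B]
    by (simp add: measure_density_prob_density[OF f])
qed

section \<open>Total variation from differences on single sets\<close>

text \<open>The cells of a partition are grouped by the sign of the difference. Within a group the
  absolute values add up to the absolute difference on the union, which is at most e; the two groups
  give the factor 2.\<close>

lemma tv_norm_diff_le:
  assumes "finite_measure M" "finite_measure N" and sets: "sets M = sets N" and "0 \<le> e"
    and le: "\<And>A. A \<in> sets M \<Longrightarrow> \<bar>measure M A - measure N A\<bar> \<le> e"
  shows "tv_norm_diff M N \<le> ennreal (2 * e)"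
  unfolding tv_norm_diff_def
proof (rule SUP_least)
  interpret M: finite_measure M by fact
  interpret N: finite_measure N by fact
  fix P assume "P \<in> {P. finite P \<and> partition_on (space M) P \<and> P \<subseteq> sets M}"
  then have fin: "finite P" and disj: "disjoint P" and P: "P \<subseteq> sets M"
    by (auto simp: partition_on_def)
  have part: "(\<Sum>A\<in>Q. measure M A - measure N A) = measure M (\<Union>Q) - measure N (\<Union>Q)"
    if "Q \<subseteq> P" for Q
  proof -
    have Q: "finite Q" "Q \<subseteq> sets M" using that fin P by (auto intro: finite_subset)
    have "disjoint_family_on (\<lambda>A. A) Q"
      unfolding disjoint_family_on_def using that disj by (meson disjoint_def subsetD)
    note Q = Q this
    show ?thesis
      using M.finite_measure_finite_Union[of Q "\<lambda>A. A"] N.finite_measure_finite_Union[of Q "\<lambda>A. A"] Q sets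
      by (simp add: sum_subtractf)
  qed
  have sgn: "(\<Sum>A\<in>Q. \<bar>measure M A - measure N A\<bar>) \<le> e"
    if Q: "Q \<subseteq> P" and c: "\<And>A. A \<in> Q \<Longrightarrow> \<bar>measure M A - measure N A\<bar> = c * (measure M A - measure N A)"
      "\<bar>c\<bar> = 1" for Q and c :: real
  proof -
    have "(\<Sum>A\<in>Q. \<bar>measure M A - measure N A\<bar>) = c * (measure M (\<Union>Q) - measure N (\<Union>Q))"
      using c by (simp add: part[OF Q, symmetric] sum_distrib_left)
    also have "\<dots> \<le> \<bar>c * (measure M (\<Union>Q) - measure N (\<Union>Q))\<bar>" by (rule abs_ge_self)
    also have "\<dots> = \<bar>measure M (\<Union>Q) - measure N (\<Union>Q)\<bar>" using c(2) by (simp add: abs_mult)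
    also have "\<dots> \<le> e"
      using Q P fin by (intro le sets.finite_Union) (auto intro: finite_subset)
    finally show ?thesis .
  qed
  define Q where "Q = {A\<in>P. measure N A \<le> measure M A}"
  have "(\<Sum>A\<in>P. \<bar>measure M A - measure N A\<bar>)
     = (\<Sum>A\<in>P - Q. \<bar>measure M A - measure N A\<bar>) + (\<Sum>A\<in>Q. \<bar>measure M A - measure N A\<bar>)"
    using fin by (intro sum.subset_diff) (auto simp: Q_def)
  also have "\<dots> \<le> e + e"
    by (intro add_mono sgn[where c = "-1"] sgn[where c = 1]) (auto simp: Q_def)
  finally show "(\<Sum>A\<in>P. ennreal \<bar>measure M A - measure N A\<bar>) \<le> ennreal (2 * e)"
    by (simp add: sum_ennreal ennreal_leI)
qed

section \<open>The hybrid vectors and one step between them\<close>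

text \<open>Interpolates between the rescaled vector (\<open>j = 0\<close>) and the original one (\<open>j = k\<close>): the first
  \<open>j\<close> coordinates are kept, and the remaining ones are rescaled so as to land on Kac's sphere.\<close>

definition hybrid :: "nat \<Rightarrow> nat \<Rightarrow> nat \<Rightarrow> (nat \<Rightarrow> real) \<Rightarrow> nat \<Rightarrow> real" where
  "hybrid n k j x = (\<lambda>i\<in>{..<k}. if i < j then x i
     else sqrt (real n - (\<Sum>l<j. (x l)\<^sup>2)) / sqrt (\<Sum>l=j..<n. (x l)\<^sup>2) * x i)"

lemma hybrid_0: "k \<le> n \<Longrightarrow> hybrid n k 0 x = restrict (sphere_proj n x) {..<k}"
  by (auto simp: hybrid_def sphere_proj_def fun_eq_iff atLeast0LessThan)

lemma hybrid_self: "hybrid n k k x = restrict x {..<k}"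
  by (auto simp: hybrid_def fun_eq_iff)

text \<open>For z = radial_scale \<rho> q y one has \<rho>^2 - z^2 = \<rho>^2 * q / (y^2 + q). Hence
  the factor for the later coordinates, recomputed once z is in place, is sqrt (\<rho>^2 - z^2) /
  sqrt q = \<rho> / sqrt (y^2 + q), the factor already used for y. Rescaling everything from j on is
  therefore the same as rescaling coordinate j first and the rest afterwards.\<close>

lemma hybrid_update:
  fixes x :: "nat \<Rightarrow> real"
  assumes j: "j < n"
  defines "\<rho> \<equiv> sqrt (real n - (\<Sum>l<j. (x l)\<^sup>2))" and "q \<equiv> \<Sum>l=Suc j..<n. (x l)\<^sup>2"
  assumes pos: "(\<Sum>l<j. (x l)\<^sup>2) < real n" "0 < q"
  shows "hybrid n k j (x(j := y)) = hybrid n k (Suc j) (x(j := radial_scale \<rho> q y))"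
proof
  fix i
  have rho: "\<rho>\<^sup>2 = real n - (\<Sum>l<j. (x l)\<^sup>2)" "0 < \<rho>" using pos by (auto simp: \<rho>_def)
  have yq: "0 < y\<^sup>2 + q" using pos by (simp add: add_nonneg_pos)
  have below: "(\<Sum>l<j. ((x(j := z)) l)\<^sup>2) = (\<Sum>l<j. (x l)\<^sup>2)" for z by (intro sum.cong) auto
  have above: "(\<Sum>l=Suc j..<n. ((x(j := z)) l)\<^sup>2) = q" for z unfolding q_def by (intro sum.cong) auto
  have from_j: "(\<Sum>l=j..<n. ((x(j := y)) l)\<^sup>2) = y\<^sup>2 + q"
    using j above[of y] by (simp add: sum.atLeast_Suc_lessThan)
  define z where "z = radial_scale \<rho> q y"
  have z2: "z\<^sup>2 = \<rho>\<^sup>2 * y\<^sup>2 / (y\<^sup>2 + q)"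
    using yq by (simp add: z_def radial_scale_def power_mult_distrib power_divide)
  have "real n - (\<Sum>l<Suc j. ((x(j := z)) l)\<^sup>2) = \<rho>\<^sup>2 - z\<^sup>2"
    using below[of z] rho by simp
  also have "\<dots> = \<rho>\<^sup>2 * q / (y\<^sup>2 + q)" using yq unfolding z2 by (simp add: field_simps)
  finally have upto: "sqrt (real n - (\<Sum>l<Suc j. ((x(j := z)) l)\<^sup>2)) / sqrt q = \<rho> / sqrt (y\<^sup>2 + q)"
    using rho pos by (simp add: real_sqrt_mult real_sqrt_divide \<rho>_def)
  show "hybrid n k j (x(j := y)) i = hybrid n k (Suc j) (x(j := z)) i"
  proof (cases "i < k")
    case True
    consider "i < j" | "i = j" | "j < i" by linarith
    then show ?thesis
    proof cases
      case 2
      then show ?thesis using True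
        unfolding hybrid_def from_j below by (simp add: \<rho>_def z_def radial_scale_def)
    next
      case 3
      then show ?thesis using True
        unfolding hybrid_def from_j below above upto by (simp add: \<rho>_def)
    qed (use True in \<open>simp add: hybrid_def\<close>)
  qed (simp add: hybrid_def)
qed

lemma measurable_hybrid:
  assumes M: "sets M = sets borel" and "k \<le> n" "j \<le> n"
  shows "hybrid n k j \<in> measurable (PiM {..<n} (\<lambda>_. M)) (PiM {..<k} (\<lambda>_. borel))"
proof -
  have [measurable]: "(\<lambda>x. x i) \<in> borel_measurable (PiM {..<n} (\<lambda>_. M))" if "i < n" for i
  proof -
    have "(\<lambda>x. x i) \<in> measurable (PiM {..<n} (\<lambda>_. M)) M"
      using that by (intro measurable_component_singleton) auto
    then show ?thesis using M by (simp cong: measurable_cong_sets)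
  qed
  have [measurable]: "(\<lambda>x. \<Sum>l\<in>L. (x l)\<^sup>2) \<in> borel_measurable (PiM {..<n} (\<lambda>_. M))" if "L \<subseteq> {..<n}" for L
    using that by (intro borel_measurable_sum borel_measurable_power) auto
  show ?thesis
    unfolding hybrid_def using assms
    by (intro measurable_restrict measurable_If borel_measurable_times borel_measurable_divide
        borel_measurable_sqrt[THEN measurable_compose[rotated]] borel_measurable_diff) auto
qed

text \<open>Condition on all coordinates except j. Outside \<open>bad\<close>,
  \<open>hybrid_update\<close> turns the two conditional probabilities into the masses under
  \<open>M\<close> of a section B of \<open>A\<close> and of the preimage of B under
  \<open>radial_scale\<close>, which differ by at most e. On \<open>bad\<close> the difference is
  bounded by 1.\<close>

lemma measure_hybrid_step:
  fixes M :: "real measure"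
  assumes "prob_space M" and M: "sets M = sets borel" and j: "j < k" "k \<le> n"
    and A: "A \<in> sets (PiM {..<k} (\<lambda>_. borel))"
  defines "P \<equiv> PiM {..<n} (\<lambda>_. M)" and "P' \<equiv> PiM ({..<n} - {j}) (\<lambda>_. M)"
  assumes bad: "bad \<in> sets P'" and "0 \<le> e"
    and good: "\<And>x. x \<in> space P' - bad \<Longrightarrow>
       (\<Sum>l<j. (x l)\<^sup>2) < real n \<and> 0 < (\<Sum>l=Suc j..<n. (x l)\<^sup>2) \<and>
       (\<forall>B\<in>sets borel. \<bar>measure M (radial_scale (sqrt (real n - (\<Sum>l<j. (x l)\<^sup>2))) (\<Sum>l=Suc j..<n. (x l)\<^sup>2) -` B)
          - measure M B\<bar> \<le> e)"
  shows "\<bar>measure P (hybrid n k j -` A \<inter> space P) - measure P (hybrid n k (Suc j) -` A \<inter> space P)\<bar>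
     \<le> e + measure P' bad"
proof -
  interpret M: prob_space M by fact
  interpret product_sigma_finite "\<lambda>_::nat. M" by standard
  interpret PP: product_prob_space "\<lambda>_::nat. M" "{..<n}" by standard
  interpret PP': product_prob_space "\<lambda>_::nat. M" "{..<n} - {j}" by standard
  interpret P: prob_space P unfolding P_def by (rule PP.prob_space_axioms)
  interpret P': prob_space P' unfolding P'_def by (rule PP'.prob_space_axioms)
  have ins: "insert j ({..<n} - {j}) = {..<n}" using j by auto
  have [measurable]: "A \<in> sets (PiM {..<k} (\<lambda>_. borel))" "bad \<in> sets P'" by fact+
  have hyb[measurable]: "hybrid n k i \<in> measurable P (PiM {..<k} (\<lambda>_. borel))" if "i \<le> n" for i
    unfolding P_def using M j that by (intro measurable_hybrid) auto
  have upd: "(\<lambda>(x, y). x(j := y)) \<in> measurable (P' \<Otimes>\<^sub>M M) P"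
    using measurable_add_dim[of j "{..<n} - {j}" "\<lambda>_. M"] unfolding ins P_def P'_def .
  have spM: "space M = UNIV" using M by (metis sets_eq_imp_space_eq space_borel)
  have upd1: "(\<lambda>y. x(j := y)) \<in> measurable M P" if "x \<in> space P'" for x
    using measurable_compose[OF measurable_Pair1' upd] that by simp
  define G where "G i x = (indicator A (hybrid n k i x) :: real)" for i x
  have G[measurable]: "G i \<in> borel_measurable P" if "i \<le> n" for i
    using hyb[OF that] unfolding G_def by measurable
  have G01: "0 \<le> G i x" "G i x \<le> 1" for i x by (auto simp: G_def)
  define F where "F i x = (\<integral>y. G i (x(j := y)) \<partial>M)" for i x
  have intG: "integrable P (G i)" if "i \<le> n" for i
    using G[OF that] G01 by (intro P.integrable_const_bound[where B = 1]) auto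
  have mF: "F i \<in> borel_measurable P'" if "i \<le> n" for i
  proof -
    have "(\<lambda>(x, y). G i (x(j := y))) \<in> borel_measurable (P' \<Otimes>\<^sub>M M)"
      using measurable_compose[OF upd G[OF that]] by (simp add: case_prod_beta')
    then show ?thesis unfolding F_def by (rule M.borel_measurable_lebesgue_integral)
  qed
  have F01: "0 \<le> F i x" "F i x \<le> 1" for i x
  proof -
    show "0 \<le> F i x" unfolding F_def using G01 by (intro integral_nonneg_AE) auto
    show "F i x \<le> 1"
    \<comment> \<open>For x outside the space of \<open>P'\<close> the section need not be
      measurable; the Bochner integral then takes its default value 0.\<close>
    proof (cases "integrable M (\<lambda>y. G i (x(j := y)))")
      case True
      then have "F i x \<le> (\<integral>y. 1 \<partial>M)" unfolding F_def using G01 by (intro integral_mono) auto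
      then show ?thesis by (simp add: M.prob_space)
    qed (simp add: F_def not_integrable_integral_eq)
  qed
  have intF: "integrable P' (F i)" if "i \<le> n" for i
    using mF[OF that] F01 by (intro P'.integrable_const_bound[where B = 1]) auto
  have measG: "measure P (hybrid n k i -` A \<inter> space P) = (\<integral>x. F i x \<partial>P')" if "i \<le> n" for i
  proof -
    have "measure P (hybrid n k i -` A \<inter> space P) = (\<integral>x. G i x \<partial>P)"
    proof -
      have "G i = indicator (hybrid n k i -` A)" by (auto simp: G_def indicator_def)
      then show ?thesis by simp
    qed
    also have "\<dots> = (\<integral>x. F i x \<partial>P')"
      using product_integral_insert[of "{..<n} - {j}" j "G i"] intG[OF that]
      unfolding ins F_def P_def P'_def by simp
    finally show ?thesis .
  qed
  have int_bad: "integrable P' (indicator bad :: _ \<Rightarrow> real)"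
    using bad by (intro integrable_real_indicator) (auto simp: P'.emeasure_eq_measure)
  have pw: "\<bar>F j x - F (Suc j) x\<bar> \<le> e + indicator bad x" if x: "x \<in> space P'" for x
  proof (cases "x \<in> bad")
    case True
    then show ?thesis using F01[of j x] F01[of "Suc j" x] \<open>0 \<le> e\<close> by (simp add: abs_le_iff)
  next
    case False
    define \<rho> where "\<rho> = sqrt (real n - (\<Sum>l<j. (x l)\<^sup>2))"
    define q where "q = (\<Sum>l=Suc j..<n. (x l)\<^sup>2)"
    define B where "B = {z. hybrid n k (Suc j) (x(j := z)) \<in> A}"
    have "(\<lambda>z. hybrid n k (Suc j) (x(j := z))) \<in> measurable M (PiM {..<k} (\<lambda>_. borel))"
      using measurable_compose[OF upd1[OF x] hyb[of "Suc j"]] j by simp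
    from measurable_sets[OF this A] have B: "B \<in> sets borel"
      by (simp add: B_def vimage_def spM M)
    have eq: "hybrid n k j (x(j := y)) = hybrid n k (Suc j) (x(j := radial_scale \<rho> q y))" for y
      using good[of x] x False j unfolding \<rho>_def q_def by (intro hybrid_update) auto
    have "(\<lambda>y. G j (x(j := y))) = indicator (radial_scale \<rho> q -` B)"
      by (auto simp: G_def eq B_def indicator_def fun_eq_iff)
    then have "F j x = measure M (radial_scale \<rho> q -` B)" by (simp add: F_def spM)
    moreover have "(\<lambda>y. G (Suc j) (x(j := y))) = indicator B"
      by (auto simp: G_def B_def indicator_def fun_eq_iff)
    then have "F (Suc j) x = measure M B" by (simp add: F_def spM)
    ultimately show ?thesis
      using good[of x] x False B unfolding \<rho>_def q_def by auto
  qed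
  have "measure P (hybrid n k j -` A \<inter> space P) - measure P (hybrid n k (Suc j) -` A \<inter> space P)
     = (\<integral>x. F j x - F (Suc j) x \<partial>P')"
    using measG[of j] measG[of "Suc j"] intF[of j] intF[of "Suc j"] j by simp
  moreover have "\<bar>\<integral>x. F j x - F (Suc j) x \<partial>P'\<bar> \<le> (\<integral>x. e + indicator bad x \<partial>P')"
  proof (rule order_trans[OF integral_abs_bound], rule integral_mono)
    show "integrable P' (\<lambda>x. \<bar>F j x - F (Suc j) x\<bar>)" using intF[of j] intF[of "Suc j"] j by auto
    show "integrable P' (\<lambda>x. e + indicator bad x)" using int_bad by simp
  qed (rule pw)
  moreover have "(\<integral>x. e + indicator bad x \<partial>P') = e + measure P' bad"
    using int_bad by (simp add: P'.prob_space)
  ultimately show ?thesis by simp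
qed

section \<open>Approximants, moments and measurability\<close>

text \<open>\<open>best_lipschitz\<close> is an infimum. Doubling the bound, a strict increase since
  L0 > 0, yields an actual Lipschitz constant below it without showing that the infimum is
  attained.\<close>

lemma ALip_const_obtain_approx:
  assumes "f \<in> ALip_const r L0" "0 < L0" "0 < \<epsilon>"
  obtains g L where "integrable lborel g" "L-lipschitz_on UNIV g"
    "(\<integral>x. \<bar>f x - g x\<bar> \<partial>lborel) \<le> \<epsilon>" "L \<le> 2 * L0 * \<epsilon> powr (- r)"
proof -
  from assms obtain g C where g: "integrable lborel g" "C-lipschitz_on UNIV g"
      "(\<integral>x. \<bar>f x - g x\<bar> \<partial>lborel) \<le> \<epsilon>" "best_lipschitz g \<le> L0 * \<epsilon> powr (- r)"
    unfolding ALip_const_def by blast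
  have "0 < L0 * \<epsilon> powr (- r)" using assms by simp
  then have "Inf {C. C-lipschitz_on UNIV g} < 2 * L0 * \<epsilon> powr (- r)"
    using g(4) unfolding best_lipschitz_def by linarith
  then obtain L where "L-lipschitz_on UNIV g" "L < 2 * L0 * \<epsilon> powr (- r)"
    using cInf_lessD[of "{C. C-lipschitz_on UNIV g}"] g(2) by blast
  then show ?thesis using g that[of g L] by auto
qed

lemma integrable_density_prob_density:
  fixes \<phi> :: "real \<Rightarrow> real"
  assumes f: "prob_density f" and \<phi>: "\<phi> \<in> borel_measurable borel"
  shows "integrable (density lborel f) \<phi> \<longleftrightarrow> integrable lborel (\<lambda>x. \<phi> x * f x)"
    and "(\<integral>x. \<phi> x \<partial>density lborel f) = (\<integral>x. \<phi> x * f x \<partial>lborel)"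
  using f \<phi> integrable_density[of \<phi> lborel f] integral_density[of \<phi> lborel f]
  by (auto simp: prob_density_def mult.commute)

lemma integrable_abs_powr_density_le:
  assumes f: "prob_density f" and "integrable lborel (\<lambda>x. \<bar>x\<bar> powr m * f x)" and p: "0 < p" "p \<le> m"
  shows "integrable (density lborel f) (\<lambda>x. \<bar>x\<bar> powr p)"
proof -
  interpret prob_space "density lborel f" by (rule prob_space_density_prob_density[OF f])
  have "integrable (density lborel f) (\<lambda>x. \<bar>x\<bar> powr m)"
    using assms by (simp add: integrable_density_prob_density[OF f])
  then have "integrable (density lborel f) (\<lambda>x. 1 + \<bar>x\<bar> powr m)" by simp
  then show ?thesis
  proof (rule Bochner_Integration.integrable_bound)
    have "\<bar>x\<bar> powr p \<le> 1 + \<bar>x\<bar> powr m" for x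
    proof (cases "\<bar>x\<bar> \<le> 1")
      case True
      then have "\<bar>x\<bar> powr p \<le> 1" using p by (intro powr_le1) auto
      then show ?thesis using powr_ge_zero[of "\<bar>x\<bar>" m] by linarith
    next
      case False
      then have "\<bar>x\<bar> powr p \<le> \<bar>x\<bar> powr m" using p by (intro powr_mono) auto
      then show ?thesis by linarith
    qed
    then show "AE x in density lborel f. norm (\<bar>x\<bar> powr p) \<le> norm (1 + \<bar>x\<bar> powr m)"
      by (intro AE_I2) (simp add: abs_of_nonneg)
  qed simp
qed

lemma prob_space_tensor_power:
  assumes "prob_density f"
  shows "prob_space (tensor_power n f)"
  unfolding tensor_power_def using prob_space_density_prob_density[OF assms] by (intro prob_space_PiM)

lemma sets_tensor_power: "sets (tensor_power n f) = sets (PiM {..<n} (\<lambda>_. borel))"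
  unfolding tensor_power_def by (intro sets_PiM_cong) auto

lemma measurable_sphere_proj:
  "sphere_proj n \<in> measurable (tensor_power n f) (PiM {..<n} (\<lambda>_. borel))"
proof -
  have "sphere_proj n = hybrid n n 0"
    using hybrid_0[of n n] by (auto simp: sphere_proj_def fun_eq_iff hybrid_def restrict_def)
  then show ?thesis by (simp add: tensor_power_def measurable_hybrid)
qed

section \<open>Concentration of sums of squares and comparison of the marginals\<close>

context
  fixes f :: "real \<Rightarrow> real" and \<delta> :: real
  assumes f: "prob_density f" and \<delta>: "0 < \<delta>" "\<delta> \<le> 2"
    and second_moment: "(\<integral>x. x\<^sup>2 * f x \<partial>lborel) = 1"
    and moment: "integrable lborel (\<lambda>x. \<bar>x\<bar> powr (2 + \<delta>) * f x)"
begin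

lemma integrable_square: "integrable (density lborel f) (\<lambda>x. x\<^sup>2)"
  using integrable_abs_powr_density_le[OF f moment, of 2] \<delta> by simp

lemma integral_square: "(\<integral>x. x\<^sup>2 \<partial>density lborel f) = 1"
  using second_moment by (simp add: integrable_density_prob_density[OF f])

text \<open>Squaring halves the order of the available moment, from 2 + \<delta> to 1 + \<delta> /
  2. The condition \<delta> \<le> 2 keeps this order in the range (1, 2] of the von Bahr-Esseen
  inequality.\<close>

lemma integrable_centered_square_powr:
  "integrable (density lborel f) (\<lambda>x. \<bar>x\<^sup>2 - 1\<bar> powr (1 + \<delta> / 2))"
proof -
  interpret prob_space "density lborel f" by (rule prob_space_density_prob_density[OF f])
  let ?p = "1 + \<delta> / 2"
  have "integrable (density lborel f) (\<lambda>x. \<bar>x\<bar> powr (2 + \<delta>))"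
    using integrable_abs_powr_density_le[OF f moment] \<delta> by simp
  then have "integrable (density lborel f) (\<lambda>x. 1 + \<bar>x\<bar> powr (2 + \<delta>))" by simp
  then show ?thesis
  proof (rule Bochner_Integration.integrable_bound)
    have "\<bar>x\<^sup>2 - 1\<bar> powr ?p \<le> 1 + \<bar>x\<bar> powr (2 + \<delta>)" for x :: real
    proof (cases "\<bar>x\<bar> \<le> 1")
      case True
      then have "x\<^sup>2 \<le> 1" by (simp add: abs_square_le_1)
      then have "\<bar>x\<^sup>2 - 1\<bar> powr ?p \<le> 1" using \<delta> by (intro powr_le1) auto
      then show ?thesis using powr_ge_zero[of "\<bar>x\<bar>" "2 + \<delta>"] by linarith
    next
      case False
      then have "1 \<le> x\<^sup>2" using abs_square_le_1[of x] by linarith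
      then have "\<bar>x\<^sup>2 - 1\<bar> powr ?p \<le> (\<bar>x\<bar> powr 2) powr ?p" using \<delta> by (intro powr_mono2) auto
      also have "\<dots> = \<bar>x\<bar> powr (2 + \<delta>)" by (simp only: powr_powr) (simp add: algebra_simps)
      finally show ?thesis by linarith
    qed
    then show "AE x in density lborel f. norm (\<bar>x\<^sup>2 - 1\<bar> powr ?p) \<le> norm (1 + \<bar>x\<bar> powr (2 + \<delta>))"
      by (intro AE_I2) (simp add: abs_of_nonneg)
  qed simp
qed

text \<open>Markov's inequality for the power 1 + \<delta> / 2 of the sum of the centred squares;
  the von Bahr-Esseen inequality bounds its expectation linearly in the number of
  coordinates.\<close>

lemma measure_PiM_sum_squares_deviation_le:
  fixes J :: "nat set"
  assumes J: "finite J" and t: "0 < t"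
  shows "measure (PiM J (\<lambda>_. density lborel f)) {x \<in> space (PiM J (\<lambda>_. density lborel f)).
      t \<le> \<bar>(\<Sum>l\<in>J. (x l)\<^sup>2) - real (card J)\<bar>}
    \<le> t powr (- (1 + \<delta> / 2)) * (6 * real (card J) * (\<integral>x. \<bar>x\<^sup>2 - 1\<bar> powr (1 + \<delta> / 2) \<partial>density lborel f))"
    (is "measure ?P ?S \<le> ?c * ?b")
proof -
  interpret M: prob_space "density lborel f" by (rule prob_space_density_prob_density[OF f])
  interpret PP: product_prob_space "\<lambda>_::nat. density lborel f" J by standard
  have [measurable]: "(\<lambda>x. x l) \<in> borel_measurable ?P" if "l \<in> J" for l
    using measurable_component_singleton[OF that, of "\<lambda>_. density lborel f"] by simp
  let ?u = "\<lambda>x. \<bar>\<Sum>l\<in>J. (x l)\<^sup>2 - 1\<bar> powr (1 + \<delta> / 2)"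
  have "emeasure ?P {x \<in> space ?P. 1 \<le> ennreal ?c * ennreal (?u x)}
     \<le> ennreal ?c * (\<integral>\<^sup>+x. ennreal (?u x) * indicator (space ?P) x \<partial>?P)"
    by (rule nn_integral_Markov_inequality) auto
  also have "(\<integral>\<^sup>+x. ennreal (?u x) * indicator (space ?P) x \<partial>?P) = (\<integral>\<^sup>+x. ennreal (?u x) \<partial>?P)"
    by (intro nn_integral_cong) simp
  also have "\<dots> \<le> ennreal ?b"
    using M.prob_space_axioms \<delta> J integrable_square integral_square integrable_centered_square_powr
    by (intro nn_integral_PiM_abs_sum_powr_le) (auto simp: M.prob_space[simplified])
  also have "ennreal ?c * ennreal ?b = ennreal (?c * ?b)"
    by (simp add: ennreal_mult')
  finally have le: "emeasure ?P {x \<in> space ?P. 1 \<le> ennreal ?c * ennreal (?u x)} \<le> ennreal (?c * ?b)"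
    by (simp add: mult_left_mono)
  have "?S \<subseteq> {x \<in> space ?P. 1 \<le> ennreal ?c * ennreal (?u x)}"
  proof safe
    fix x assume "t \<le> \<bar>(\<Sum>l\<in>J. (x l)\<^sup>2) - real (card J)\<bar>"
    then have "t powr (1 + \<delta> / 2) \<le> ?u x"
      using t \<delta> by (intro powr_mono2) (auto simp: sum_subtractf)
    then have "?c * t powr (1 + \<delta> / 2) \<le> ?c * ?u x" by (intro mult_left_mono) auto
    then have "1 \<le> ?c * ?u x" using t by (simp flip: powr_add)
    then show "1 \<le> ennreal ?c * ennreal (?u x)"
      by (simp flip: ennreal_mult' add: ennreal_ge_1)
  qed
  then have "emeasure ?P ?S \<le> emeasure ?P {x \<in> space ?P. 1 \<le> ennreal ?c * ennreal (?u x)}"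
    by (intro emeasure_mono) auto
  with le have "emeasure ?P ?S \<le> ennreal (?c * ?b)" by (rule order_trans[rotated])
  moreover have "0 \<le> ?c * ?b" by (intro mult_nonneg_nonneg integral_nonneg_AE) auto
  ultimately show ?thesis by (simp add: PP.emeasure_eq_measure)
qed

text \<open>Markov's inequality, since each square has mean 1. It complements the deviation bound,
  which controls only the total of the squares: the share of the coordinates before j must stay well
  below n for \<rho> to be positive and q to be of order n.\<close>

lemma measure_PiM_partial_sum_squares_le:
  fixes J :: "nat set"
  assumes J: "finite J" "L \<subseteq> J" and t: "0 < t"
  shows "measure (PiM J (\<lambda>_. density lborel f)) {x \<in> space (PiM J (\<lambda>_. density lborel f)).
      t \<le> (\<Sum>l\<in>L. (x l)\<^sup>2)} \<le> real (card L) / t"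
    (is "measure ?P ?S \<le> _")
proof -
  interpret M: prob_space "density lborel f" by (rule prob_space_density_prob_density[OF f])
  interpret PP: product_prob_space "\<lambda>_::nat. density lborel f" J by standard
  have [measurable]: "(\<lambda>x. x l) \<in> borel_measurable ?P" if "l \<in> J" for l
    using measurable_component_singleton[OF that, of "\<lambda>_. density lborel f"] by simp
  have [measurable]: "(\<lambda>x. \<Sum>l\<in>L. (x l)\<^sup>2) \<in> borel_measurable ?P"
    using J by (intro borel_measurable_sum borel_measurable_power) auto
  have comp: "(\<integral>\<^sup>+x. ennreal ((x l)\<^sup>2) \<partial>?P) = 1" if "l \<in> J" for l
  proof -
    have "(\<integral>\<^sup>+x. ennreal ((x l)\<^sup>2) \<partial>?P) = (\<integral>\<^sup>+u. ennreal (u\<^sup>2) \<partial>distr ?P (density lborel f) (\<lambda>x. x l))"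
      using that by (intro nn_integral_distr[symmetric]) auto
    also have "\<dots> = (\<integral>\<^sup>+u. ennreal (u\<^sup>2) \<partial>density lborel f)"
      by (simp only: PP.PiM_component[OF that])
    also have "\<dots> = 1" using integrable_square integral_square by (subst nn_integral_eq_integral) auto
    finally show ?thesis .
  qed
  have "emeasure ?P {x \<in> space ?P. 1 \<le> ennreal (1 / t) * ennreal (\<Sum>l\<in>L. (x l)\<^sup>2)}
     \<le> ennreal (1 / t) * (\<integral>\<^sup>+x. ennreal (\<Sum>l\<in>L. (x l)\<^sup>2) * indicator (space ?P) x \<partial>?P)"
    by (rule nn_integral_Markov_inequality) auto
  also have "(\<integral>\<^sup>+x. ennreal (\<Sum>l\<in>L. (x l)\<^sup>2) * indicator (space ?P) x \<partial>?P)
     = (\<integral>\<^sup>+x. (\<Sum>l\<in>L. ennreal ((x l)\<^sup>2)) \<partial>?P)"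
    by (intro nn_integral_cong) (simp add: sum_ennreal)
  also have "\<dots> = (\<Sum>l\<in>L. (\<integral>\<^sup>+x. ennreal ((x l)\<^sup>2) \<partial>?P))"
    using J by (intro nn_integral_sum) auto
  also have "\<dots> = ennreal (real (card L))"
    using J by (simp add: comp subset_eq ennreal_of_nat_eq_real_of_nat)
  also have "ennreal (1 / t) * ennreal (real (card L)) = ennreal (real (card L) / t)"
    using t by (simp flip: ennreal_mult)
  also have "{x \<in> space ?P. 1 \<le> ennreal (1 / t) * ennreal (\<Sum>l\<in>L. (x l)\<^sup>2)} = ?S"
    using t by (auto simp: sum_nonneg pos_le_divide_eq simp flip: ennreal_mult)
  finally show ?thesis using t by (simp add: PP.emeasure_eq_measure)
qed

text \<open>The difference telescopes over the k + 1 hybrids. A step is good unless the squares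
  other than the j-th have an atypical sum or those before j add up to at least n / 4. The scales
  \<epsilon>, h and R stay free here and are balanced later.\<close>

lemma measure_marginal_diff_le:
  assumes k: "k \<le> n" "1 \<le> n"
    and g: "integrable lborel g" and lip: "L-lipschitz_on UNIV g"
    and fg: "(\<integral>x. \<bar>f x - g x\<bar> \<partial>lborel) \<le> \<epsilon>"
    and h: "0 < h" "h \<le> 1 / 8" "2 \<le> h * real n" and R: "0 < R" "R\<^sup>2 \<le> h * real n / 2"
    and A: "A \<in> sets (PiM {..<k} (\<lambda>_. borel))"
  shows "\<bar>measure (marginal k (rescaled_power n f)) A - measure (tensor_power k f) A\<bar>
    \<le> real k * (4 * \<epsilon> + 2 * ((R / 2) powr (- (2 + \<delta>)) * (\<integral>x. \<bar>x\<bar> powr (2 + \<delta>) * f x \<partial>lborel))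
       + 4 * h * (1 + \<epsilon>) + 16 * h * L * R\<^sup>2
       + ((h * real n / 2) powr (- (1 + \<delta> / 2)) * (6 * real n * (\<integral>x. \<bar>x\<^sup>2 - 1\<bar> powr (1 + \<delta> / 2) \<partial>density lborel f))
       + real k / (real n / 4)))"
    (is "_ \<le> real k * (?e + ?b)")
proof -
  define M where "M = density lborel f"
  define P where "P = PiM {..<n} (\<lambda>_. M)"
  interpret M: prob_space M unfolding M_def by (rule prob_space_density_prob_density[OF f])
  interpret PP: product_prob_space "\<lambda>_::nat. M" "{..<n}" by standard
  have setsM: "sets M = sets borel" by (simp add: M_def)
  have hyb: "hybrid n k j \<in> measurable P (PiM {..<k} (\<lambda>_. borel))" if "j \<le> n" for j
    unfolding P_def using setsM k that by (intro measurable_hybrid) auto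
  have setsk: "sets (PiM {..<k} (\<lambda>_. M)) = sets (PiM {..<k} (\<lambda>_. borel))"
    using setsM by (intro sets_PiM_cong) auto
  have proj: "sphere_proj n \<in> measurable P (PiM {..<n} (\<lambda>_. borel))"
    using measurable_sphere_proj[of n f] by (simp add: P_def M_def tensor_power_def)
  have restr: "(\<lambda>x. restrict x {..<k}) \<in> measurable (PiM {..<n} (\<lambda>_. borel)) (PiM {..<k} (\<lambda>_. borel))"
    using k by (intro measurable_restrict_subset) auto
  have hyb0: "hybrid n k 0 = (\<lambda>x. restrict (sphere_proj n x) {..<k})"
    using hybrid_0[OF k(1)] by auto
  have "marginal k (rescaled_power n f) = distr P (PiM {..<k} (\<lambda>_. borel)) (hybrid n k 0)"
    unfolding marginal_def rescaled_power_def tensor_power_def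
    using distr_distr[OF restr proj] hyb0 by (simp add: P_def M_def comp_def)
  then have marg: "measure (marginal k (rescaled_power n f)) A = measure P (hybrid n k 0 -` A \<inter> space P)"
    using measure_distr[OF hyb A] by simp
  have "tensor_power k f = distr P (PiM {..<k} (\<lambda>_. M)) (\<lambda>x. restrict x {..<k})"
    unfolding tensor_power_def P_def M_def[symmetric]
    using k by (intro PP.distr_restrict) auto
  also have "\<dots> = distr P (PiM {..<k} (\<lambda>_. borel)) (hybrid n k k)"
    using setsk by (intro distr_cong) (auto simp: hybrid_self)
  finally have tens: "measure (tensor_power k f) A = measure P (hybrid n k k -` A \<inter> space P)"
    using measure_distr[OF hyb A] k by simp
  have L: "0 \<le> L" using lip by (rule lipschitz_on_nonneg)
  have e0: "0 \<le> ?e"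
  proof -
    have "0 \<le> \<epsilon>" using fg by (rule order_trans[rotated]) (intro integral_nonneg_AE, auto)
    moreover have "0 \<le> (\<integral>x. \<bar>x\<bar> powr (2 + \<delta>) * f x \<partial>lborel)"
      using f by (intro integral_nonneg_AE) (auto simp: prob_density_def)
    ultimately show ?thesis using L h by (intro add_nonneg_nonneg mult_nonneg_nonneg) auto
  qed
  have step: "\<bar>measure P (hybrid n k j -` A \<inter> space P) - measure P (hybrid n k (Suc j) -` A \<inter> space P)\<bar>
      \<le> ?e + ?b" if j: "j < k" for j
  proof -
    define J where "J = {..<n} - {j}"
    define P' where "P' = PiM J (\<lambda>_. M)"
    interpret PP': product_prob_space "\<lambda>_::nat. M" J by standard
    interpret P': prob_space P' unfolding P'_def by (rule PP'.prob_space_axioms)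
    have [measurable]: "(\<lambda>x. x l) \<in> borel_measurable P'" if "l \<in> J" for l
      using measurable_component_singleton[OF that, of "\<lambda>_. M"] by (simp add: P'_def M_def)
    have J: "finite J" "{..<j} \<subseteq> J" "real (card J) = real n - 1"
      using j k by (auto simp: J_def of_nat_diff)
    have sumJ: "(\<Sum>l\<in>J. x l) = (\<Sum>l<j. x l) + (\<Sum>l=Suc j..<n. x l)" for x :: "nat \<Rightarrow> real"
    proof -
      have "J = {..<j} \<union> {Suc j..<n}" using j k by (auto simp: J_def)
      moreover have "{..<j} \<inter> {Suc j..<n} = {}" by auto
      ultimately show ?thesis by (simp only: sum.union_disjoint finite_lessThan finite_atLeastLessThan)
    qed
    define bad1 where "bad1 = {x \<in> space P'. h * real n / 2 \<le> \<bar>(\<Sum>l\<in>J. (x l)\<^sup>2) - real (card J)\<bar>}"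
    define bad2 where "bad2 = {x \<in> space P'. real n / 4 \<le> (\<Sum>l<j. (x l)\<^sup>2)}"
    have bads: "bad1 \<in> sets P'" "bad2 \<in> sets P'"
      unfolding bad1_def bad2_def using J by (measurable; auto)+
    have "measure P' (bad1 \<union> bad2) \<le> measure P' bad1 + measure P' bad2"
      using bads by (intro measure_Un_le)
    also have "measure P' bad1 \<le> (h * real n / 2) powr (- (1 + \<delta> / 2)) * (6 * real (card J) *
        (\<integral>x. \<bar>x\<^sup>2 - 1\<bar> powr (1 + \<delta> / 2) \<partial>M))"
      unfolding bad1_def P'_def M_def using h J k by (intro measure_PiM_sum_squares_deviation_le) auto
    also have "\<dots> \<le> (h * real n / 2) powr (- (1 + \<delta> / 2)) * (6 * real n *
        (\<integral>x. \<bar>x\<^sup>2 - 1\<bar> powr (1 + \<delta> / 2) \<partial>M))"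
      using J(3) by (intro mult_left_mono mult_right_mono integral_nonneg_AE) auto
    also have "measure P' bad2 \<le> real (card {..<j}) / (real n / 4)"
      unfolding bad2_def P'_def M_def using J k by (intro measure_PiM_partial_sum_squares_le) auto
    also have "\<dots> \<le> real k / (real n / 4)" using j by (intro divide_right_mono) auto
    finally have meas_bad: "measure P' (bad1 \<union> bad2) \<le> ?b" by (simp add: M_def)
    have "\<bar>measure P (hybrid n k j -` A \<inter> space P) - measure P (hybrid n k (Suc j) -` A \<inter> space P)\<bar>
      \<le> ?e + measure P' (bad1 \<union> bad2)"
      unfolding P_def P'_def J_def
    proof (rule measure_hybrid_step[OF M.prob_space_axioms setsM j k(1) A _ e0])
      show "bad1 \<union> bad2 \<in> sets (PiM ({..<n} - {j}) (\<lambda>_. M))" using bads by (simp add: P'_def J_def)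
      fix x assume "x \<in> space (PiM ({..<n} - {j}) (\<lambda>_. M)) - (bad1 \<union> bad2)"
      then have x: "\<bar>(\<Sum>l\<in>J. (x l)\<^sup>2) - real (card J)\<bar> < h * real n / 2" "(\<Sum>l<j. (x l)\<^sup>2) < real n / 4"
        by (auto simp: bad1_def bad2_def P'_def J_def)
      define a where "a = (\<Sum>l<j. (x l)\<^sup>2)"
      define q where "q = (\<Sum>l=Suc j..<n. (x l)\<^sup>2)"
      have "\<bar>a + q - (real n - 1)\<bar> < h * real n / 2"
        using x(1) unfolding sumJ J(3) a_def q_def .
      moreover have a: "a < real n / 4" using x(2) unfolding a_def .
      \<comment> \<open>Leaving out coordinate j makes the mean n - 1 although the squared radius is
        n; the hypothesis 2 \<le> h * n absorbs this 1 into the other half of h * n.\<close>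
      ultimately have dev: "\<bar>(real n - a) - q\<bar> \<le> h * real n" using h(3) by linarith
      have hn: "h * real n \<le> real n / 8" using mult_right_mono[OF h(2), of "real n"] by simp
      \<comment> \<open>At least n - n / 4 - n / 8 is left for q. Bounds in terms of n thus become
        bounds in terms of q at the price of a factor 2, which is the 2 in
        \<open>close\<close>.\<close>
      have q: "real n / 2 \<le> q" using dev a hn by linarith
      have n0: "0 < real n" using k by simp
      have hq: "h * real n / 2 \<le> h * q" using mult_left_mono[OF q, of h] h(1) by simp
      have close: "\<bar>(sqrt (real n - a))\<^sup>2 - q\<bar> \<le> 2 * h * q" using dev a n0 hq by simp
      have Rq: "R\<^sup>2 \<le> h * q" using R(2) hq by linarith
      show "a < real n \<and> 0 < q \<and>
       (\<forall>B\<in>sets borel. \<bar>measure M (radial_scale (sqrt (real n - a)) q -` B) - measure M B\<bar> \<le> ?e)"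
        unfolding M_def
        using measure_radial_scale_diff_le[OF f _ moment g lip fg h(1,2) _ _ close R(1) Rq] a n0 q \<delta>
        by auto
    qed
    then show ?thesis using meas_bad by linarith
  qed
  have "\<bar>measure P (hybrid n k 0 -` A \<inter> space P) - measure P (hybrid n k j -` A \<inter> space P)\<bar>
      \<le> real j * (?e + ?b)" if "j \<le> k" for j
    using that
  proof (induction j)
    case (Suc j)
    then have "\<bar>measure P (hybrid n k 0 -` A \<inter> space P) - measure P (hybrid n k (Suc j) -` A \<inter> space P)\<bar>
      \<le> real j * (?e + ?b) + (?e + ?b)"
      using step[of j] by linarith
    then show ?case by (simp only: of_nat_Suc distrib_right mult_1_left add.commute)
  qed simp
  from this[of k] show ?thesis unfolding marg tens by simp
qed

end

section \<open>Uniformity in k\<close>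

lemma square_powr_trade_off:
  fixes \<delta> a :: real
  assumes \<delta>: "0 < \<delta>" and a: "0 < a"
  obtains C where "0 < C"
    "\<And>n k. 1 \<le> k \<Longrightarrow> k \<le> n \<Longrightarrow>
       min 1 ((real k)\<^sup>2 * real n powr (- (\<delta> / (1 + a)))) \<le> C * real n powr (- (\<delta> / (real k + a)))"
proof
  \<comment> \<open>The gap \<delta> / (1 + a) - \<delta> / (2 + a) between the exponents for k = 1
    and k = 2.\<close>
  define c where "c = \<delta> / ((1 + a) * (2 + a))"
  have c: "0 < c" using assms by (simp add: c_def)
  define C where "C = exp (2 * \<delta> / c)"
  have C1: "1 \<le> C" using \<delta> c by (simp add: C_def)
  show "0 < C" by (simp add: C_def)
  fix n k :: nat assume k: "1 \<le> k" "k \<le> n"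
  have n: "1 \<le> real n" using k by simp
  show "min 1 ((real k)\<^sup>2 * real n powr (- (\<delta> / (1 + a)))) \<le> C * real n powr (- (\<delta> / (real k + a)))"
  \<comment> \<open>Below the threshold k^2 \<le> n powr c, which the gap absorbs. The case k = 1
    stands apart: the two exponents agree there and k^2 = 1.\<close>
  proof (cases "k = 1 \<or> real k \<le> real n powr (c / 2)")
    case True
    have "(real k)\<^sup>2 * real n powr (- (\<delta> / (1 + a))) \<le> 1 * real n powr (- (\<delta> / (real k + a)))"
    proof (cases "k = 1")
      case False
      then have le: "real k \<le> real n powr (c / 2)" using True by simp
      have k2: "2 \<le> real k" using k False by linarith
      have "(real k)\<^sup>2 \<le> (real n powr (c / 2))\<^sup>2" using le by (intro power_mono) auto
      also have "\<dots> = real n powr c" by (simp add: power2_eq_square flip: powr_add)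
      finally have "(real k)\<^sup>2 * real n powr (- (\<delta> / (1 + a))) \<le> real n powr c * real n powr (- (\<delta> / (1 + a)))"
        by (intro mult_right_mono) auto
      also have "\<dots> = real n powr (c - \<delta> / (1 + a))" by (simp flip: powr_add)
      also have "\<dots> \<le> real n powr (- (\<delta> / (real k + a)))"
      proof (rule powr_mono[OF _ n])
        have "\<delta> / (real k + a) \<le> \<delta> / (2 + a)" using assms k2 by (intro divide_left_mono) auto
        also have "\<dots> = \<delta> / (1 + a) - c"
        proof -
          have "1 + a \<noteq> 0" "2 + a \<noteq> 0" using a by auto
          then show ?thesis by (simp add: c_def divide_simps) (simp add: algebra_simps)
        qed
        finally show "c - \<delta> / (1 + a) \<le> - (\<delta> / (real k + a))" by linarith
      qed
      finally show ?thesis by simp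
    qed simp
    also have "\<dots> \<le> C * real n powr (- (\<delta> / (real k + a)))"
      using C1 by (intro mult_right_mono) auto
    finally show ?thesis by linarith
  next
    case False
    \<comment> \<open>Beyond the threshold ln n is at most linear in k, while \<delta> / (k + a)
      decays at least like \<delta> / k. Their product is at most 2 * \<delta> / c, so the target
      power of n is at least 1 / C.\<close>
    have "ln (real n) \<le> real n powr (c / 2) / (c / 2)" using n c by (intro ln_powr_bound) auto
    also have "\<dots> \<le> real k / (c / 2)" using False c by (intro divide_right_mono) auto
    finally have ln: "ln (real n) \<le> 2 * real k / c" by (simp add: mult.commute)
    have "\<delta> / (real k + a) * ln (real n) \<le> \<delta> / real k * (2 * real k / c)"
      using assms k n ln by (intro mult_mono divide_left_mono) auto
    also have "\<dots> = 2 * \<delta> / c" using k by simp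
    finally have "exp (- (2 * \<delta> / c)) \<le> real n powr (- (\<delta> / (real k + a)))"
      using n by (simp add: powr_def)
    then have "C * exp (- (2 * \<delta> / c)) \<le> C * real n powr (- (\<delta> / (real k + a)))"
      by (intro mult_left_mono) (auto simp: C_def)
    moreover have "C * exp (- (2 * \<delta> / c)) = 1" by (simp add: C_def flip: exp_add)
    ultimately show ?thesis by linarith
  qed
qed

section \<open>Choice of the scales and conclusion\<close>

lemma prob_space_marginal_rescaled_power:
  assumes f: "prob_density f" and k: "k \<le> n"
  shows "prob_space (marginal k (rescaled_power n f))"
proof -
  have "prob_space (rescaled_power n f)"
    unfolding rescaled_power_def
    by (rule prob_space.prob_space_distr[OF prob_space_tensor_power[OF f] measurable_sphere_proj])
  then show ?thesis
    unfolding marginal_def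
  proof (rule prob_space.prob_space_distr)
    show "(\<lambda>x. restrict x {..<k}) \<in> measurable (rescaled_power n f) (PiM {..<k} (\<lambda>_. borel))"
      unfolding rescaled_power_def measurable_distr_eq1 using k by (intro measurable_restrict_subset) auto
  qed
qed

text \<open>The scales make every error a multiple of \<epsilon>. With m = 2 + \<delta>, the tail R
  powr (-m) gives R = \<epsilon> powr (-1/m). The Lipschitz term h * \<epsilon> powr (-r) * R^2
  makes h of order \<epsilon> powr s with s = 1 + r + 2/m. The deviation probability n * (h * n)
  powr (-m/2) then requires n powr (-\<delta>/2) = \<epsilon> powr (1 + s * m / 2), that is
  \<epsilon> = n powr (-\<delta>/a) with a = 2 + s * m = 6 + \<delta> + r * (2 + \<delta>).\<close>

lemma marginal_total_variation_bound:
  fixes f :: "real \<Rightarrow> real" and r \<delta> :: real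
  assumes r: "0 \<le> r" and f: "prob_density f" and ALip: "f \<in> ALip r"
    and second_moment: "(\<integral>x. x\<^sup>2 * f x \<partial>lborel) = 1" and \<delta>: "0 < \<delta>" "\<delta> \<le> 2"
    and moment: "integrable lborel (\<lambda>x. \<bar>x\<bar> powr (2 + \<delta>) * f x)"
  obtains C where "0 < C"
    "\<And>n k A. 1 \<le> k \<Longrightarrow> k \<le> n \<Longrightarrow> A \<in> sets (PiM {..<k} (\<lambda>_. borel)) \<Longrightarrow>
       \<bar>measure (marginal k (rescaled_power n f)) A - measure (tensor_power k f) A\<bar>
         \<le> C * min 1 ((real k)\<^sup>2 * real n powr (- (\<delta> / (6 + \<delta> + r * (2 + \<delta>)))))"
proof -
  define m where "m = 2 + \<delta>"
  define a where "a = 6 + \<delta> + r * (2 + \<delta>)"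
  define s where "s = 1 + r + 2 / m"
  define K where "K = (\<integral>x. \<bar>x\<bar> powr m * f x \<partial>lborel)"
  define K' where "K' = (\<integral>x. \<bar>x\<^sup>2 - 1\<bar> powr (1 + \<delta> / 2) \<partial>density lborel f)"
  obtain L0 where L0: "0 < L0" "f \<in> ALip_const r L0" using ALip by (auto simp: ALip_def)
  have K: "0 \<le> K" "0 \<le> K'"
    using f unfolding K_def K'_def by (intro integral_nonneg_AE, auto simp: prob_density_def)+
  have m: "2 < m" "m \<le> 4" using \<delta> by (auto simp: m_def)
  have s1: "1 \<le> s" using r m by (simp add: s_def)
  have rd: "0 \<le> r * (2 + \<delta>)" using r \<delta> by simp
  have a0: "0 < a" "\<delta> \<le> a" using rd \<delta> by (auto simp: a_def)
  have a_eq: "a = m * (s + 2 / m)"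
  proof -
    have "m * (s + 2 / m) = m + m * r + 4" using m by (simp add: s_def distrib_left)
    then show ?thesis by (simp add: a_def m_def algebra_simps)
  qed
  \<comment> \<open>Written in powers of \<epsilon>, this is the constraint R^2 \<le> h * n / 2; it
    follows from \<delta> \<le> m.\<close>
  have a_ge: "s + 2 / m \<le> a / \<delta>"
  proof -
    have "1 * (s + 2 / m) \<le> m / \<delta> * (s + 2 / m)"
      using m \<delta> s1 by (intro mult_right_mono) (auto simp: m_def pos_le_divide_eq)
    then show ?thesis by (simp add: a_eq)
  qed
  \<comment> \<open>Collects the coefficients of \<epsilon> below: 24 consists of 4 for the
    approximation, 16 for the norm of the approximant and 4 for the coordinates before the current
    one.\<close>
  define C where "C = 24 + 32 * K + 64 * L0 + 6 * K'"
  have C: "24 \<le> C" using K L0 by (simp add: C_def)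
  show ?thesis
  proof
    show "0 < C" using C by simp
    fix n k :: nat and A :: "(nat \<Rightarrow> real) set"
    assume k: "1 \<le> k" "k \<le> n" and A: "A \<in> sets (PiM {..<k} (\<lambda>_. borel))"
    define \<epsilon> where "\<epsilon> = real n powr (- (\<delta> / a))"
    have n: "1 \<le> real n" using k by simp
    have \<epsilon>: "0 < \<epsilon>" "\<epsilon> \<le> 1"
      using n a0 \<delta> powr_mono[of "- (\<delta> / a)" 0 "real n"] by (auto simp: \<epsilon>_def)
    have n_eq: "real n = \<epsilon> powr (- (a / \<delta>))"
      using a0 \<delta> n by (simp add: \<epsilon>_def powr_powr)
    have k1: "1 \<le> real k" "1 \<le> (real k)\<^sup>2" "real k \<le> (real k)\<^sup>2"
      using k one_le_power[of "real k" 2] self_le_power[of "real k" 2] by simp_all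
    let ?d = "\<bar>measure (marginal k (rescaled_power n f)) A - measure (tensor_power k f) A\<bar>"
    have d1: "?d \<le> 1"
    proof -
      have p: "prob_space (marginal k (rescaled_power n f))" "prob_space (tensor_power k f)"
        by (rule prob_space_marginal_rescaled_power[OF f k(2)] prob_space_tensor_power[OF f])+
      show ?thesis
        using prob_space.prob_le_1[OF p(1), of A] prob_space.prob_le_1[OF p(2), of A]
          measure_nonneg[of "marginal k (rescaled_power n f)" A] measure_nonneg[of "tensor_power k f" A]
        by linarith
    qed
    have main: "?d \<le> C * ((real k)\<^sup>2 * \<epsilon>)"
    proof (cases "2 * \<epsilon> powr s \<le> 1 / 8")
      \<comment> \<open>Here h would exceed 1 / 8, but then \<epsilon> > 1 / 16 and the trivial
        bound 1 is good enough.\<close>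
      case False
      have "\<epsilon> powr s \<le> \<epsilon> powr 1" using \<epsilon> s1 by (intro powr_mono') auto
      then have "1 \<le> 16 * \<epsilon>" using False \<epsilon> by simp
      also have "\<dots> \<le> C * ((real k)\<^sup>2 * \<epsilon>)"
      proof (intro mult_mono)
        show "\<epsilon> \<le> (real k)\<^sup>2 * \<epsilon>" using k1(2) \<epsilon> by simp
      qed (use C \<epsilon> in auto)
      finally show ?thesis using d1 by linarith
    next
      case True
      define h where "h = 2 * \<epsilon> powr s"
      define R where "R = \<epsilon> powr (- (1 / m))"
      have h: "0 < h" "h \<le> 1 / 8" using True \<epsilon> by (auto simp: h_def)
      have R0: "0 < R" using \<epsilon> by (simp add: R_def)
      have R2: "R\<^sup>2 = \<epsilon> powr (- (2 / m))" using \<epsilon> by (simp add: R_def powr_power)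
      have hn: "h * real n / 2 = \<epsilon> powr (s - a / \<delta>)"
        by (simp add: h_def n_eq flip: powr_add)
      have R: "R\<^sup>2 \<le> h * real n / 2"
        unfolding R2 hn using \<epsilon> a_ge by (intro powr_mono') auto
      have "1 \<le> R\<^sup>2"
        unfolding R2 using powr_mono'[of "- (2 / m)" 0 \<epsilon>] \<epsilon> m by simp
      then have hn2: "2 \<le> h * real n" using R by linarith
      obtain g L where g: "integrable lborel g" "L-lipschitz_on UNIV g"
          "(\<integral>x. \<bar>f x - g x\<bar> \<partial>lborel) \<le> \<epsilon>" "L \<le> 2 * L0 * \<epsilon> powr (- r)"
        using ALip_const_obtain_approx[OF L0(2,1) \<epsilon>(1)] by blast
      have h\<epsilon>: "h \<le> 2 * \<epsilon>"
        using powr_mono'[OF s1, of \<epsilon>] \<epsilon> by (simp add: h_def)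
      have tail: "2 * ((R / 2) powr (- m) * K) \<le> 32 * K * \<epsilon>"
      proof -
        have "(R / 2) powr (- m) = 2 powr m * R powr (- m)"
          using R0 by (simp add: powr_divide powr_minus_divide)
        also have "R powr (- m) = \<epsilon>" using \<epsilon> m by (simp add: R_def powr_powr)
        also have "2 powr m * \<epsilon> \<le> 2 powr 4 * \<epsilon>" using m \<epsilon> by (intro mult_right_mono powr_mono) auto
        finally have "(R / 2) powr (- m) * K \<le> 16 * \<epsilon> * K" using K by (intro mult_right_mono) auto
        then show ?thesis by (simp add: mult_ac)
      qed
      have norm: "4 * h * (1 + \<epsilon>) \<le> 16 * \<epsilon>"
      proof -
        have "4 * h * (1 + \<epsilon>) \<le> 4 * (2 * \<epsilon>) * 2" using h h\<epsilon> \<epsilon> by (intro mult_mono) auto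
        then show ?thesis by simp
      qed
      have lip: "16 * h * L * R\<^sup>2 \<le> 64 * L0 * \<epsilon>"
      proof -
        have "16 * h * L * R\<^sup>2 \<le> 16 * h * (2 * L0 * \<epsilon> powr (- r)) * R\<^sup>2"
          using h g(4) by (intro mult_right_mono mult_left_mono) auto
        also have "\<dots> = 64 * L0 * (\<epsilon> powr s * \<epsilon> powr (- r) * \<epsilon> powr (- (2 / m)))"
          by (simp add: h_def R2)
        also have "\<epsilon> powr s * \<epsilon> powr (- r) * \<epsilon> powr (- (2 / m)) = \<epsilon>"
          using \<epsilon> by (simp add: s_def flip: powr_add)
        finally show ?thesis .
      qed
      have dev: "(h * real n / 2) powr (- (1 + \<delta> / 2)) * (6 * real n * K') = 6 * K' * \<epsilon>"
      proof -
        have "(h * real n / 2) powr (- (1 + \<delta> / 2)) * real n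
            = \<epsilon> powr ((s - a / \<delta>) * (- (1 + \<delta> / 2)) + - (a / \<delta>))"
          unfolding hn powr_powr by (simp only: powr_add n_eq[symmetric])
        \<comment> \<open>That this exponent equals 1 is the equation that determines
          \<open>a\<close>.\<close>
        also have "(s - a / \<delta>) * (- (1 + \<delta> / 2)) + - (a / \<delta>) = a / 2 - s * m / 2"
          using \<delta> by (simp add: m_def field_simps)
        also have "\<dots> = 1" using m by (simp add: a_eq field_simps)
        finally show ?thesis using \<epsilon> by (simp add: mult_ac)
      qed
      have early: "real k / (real n / 4) \<le> 4 * real k * \<epsilon>"
      proof -
        have "real n powr (- 1) \<le> \<epsilon>"
          unfolding \<epsilon>_def using a0 n by (intro powr_mono) auto
        then have "1 / real n \<le> \<epsilon>" using n by (simp add: powr_minus_divide)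
        then have "4 * real k * (1 / real n) \<le> 4 * real k * \<epsilon>" by (intro mult_left_mono) auto
        then show ?thesis by (simp add: mult_ac)
      qed
      have "?d \<le> real k * (4 * \<epsilon> + 2 * ((R / 2) powr (- m) * K) + 4 * h * (1 + \<epsilon>) + 16 * h * L * R\<^sup>2
          + ((h * real n / 2) powr (- (1 + \<delta> / 2)) * (6 * real n * K') + real k / (real n / 4)))"
        unfolding K_def K'_def m_def using k
        by (intro measure_marginal_diff_le[OF f \<delta> second_moment moment _ _ g(1-3) h hn2 R0 R A]) auto
      also have "\<dots> \<le> real k * (4 * \<epsilon> + 32 * K * \<epsilon> + 16 * \<epsilon> + 64 * L0 * \<epsilon> + (6 * K' * \<epsilon> + 4 * real k * \<epsilon>))"
        using tail norm lip dev early by (intro mult_left_mono add_mono) auto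
      also have "\<dots> = real k * \<epsilon> * (20 + 32 * K + 64 * L0 + 6 * K') + 4 * ((real k)\<^sup>2 * \<epsilon>)"
        by (simp add: algebra_simps power2_eq_square)
      also have "\<dots> \<le> (real k)\<^sup>2 * \<epsilon> * (20 + 32 * K + 64 * L0 + 6 * K') + 4 * ((real k)\<^sup>2 * \<epsilon>)"
        using k1 K L0 \<epsilon> by (intro add_right_mono mult_right_mono) auto
      also have "\<dots> = C * ((real k)\<^sup>2 * \<epsilon>)" by (simp add: C_def algebra_simps)
      finally show ?thesis .
    qed
    show "?d \<le> C * min 1 ((real k)\<^sup>2 * real n powr (- (\<delta> / (6 + \<delta> + r * (2 + \<delta>)))))"
      using main d1 C unfolding \<epsilon>_def a_def min_def by auto
  qed
qed

theorem theorem10: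
  fixes f :: "real \<Rightarrow> real" and r \<delta> :: real
  assumes "0 \<le> r"
    and "prob_density f"
    and "f \<in> ALip r"
    and "(\<integral>x. x\<^sup>2 * f x \<partial>lborel) = 1"
    and "0 < \<delta>" and "\<delta> \<le> 2"
    and "integrable lborel (\<lambda>x. \<bar>x\<bar> powr (2 + \<delta>) * f x)"
  shows "\<exists>C0::real. \<forall>N k. 1 \<le> k \<and> k \<le> N \<longrightarrow>
           tv_norm_diff (marginal k (rescaled_power N f)) (tensor_power k f)
             \<le> ennreal (C0 * real N powr (- (\<delta> / (real k + 5 + \<delta> + r * (2 + \<delta>)))))"
proof -
  \<comment> \<open>One less than the denominator 6 + \<delta> + r * (2 + \<delta>) of the case k =
    1, so that the exponent for general k reads \<delta> / (k + a).\<close>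
  define a where "a = 5 + \<delta> + r * (2 + \<delta>)"
  have "0 \<le> r * (2 + \<delta>)" using assms by simp
  then have a: "0 < a" unfolding a_def using assms(5) by linarith
  obtain C where C: "0 < C"
    "\<And>n k A. 1 \<le> k \<Longrightarrow> k \<le> n \<Longrightarrow> A \<in> sets (PiM {..<k} (\<lambda>_. borel)) \<Longrightarrow>
       \<bar>measure (marginal k (rescaled_power n f)) A - measure (tensor_power k f) A\<bar>
         \<le> C * min 1 ((real k)\<^sup>2 * real n powr (- (\<delta> / (1 + a))))"
  proof (rule marginal_total_variation_bound[OF assms], goal_cases)
    case (1 C)
    have "1 + a = 6 + \<delta> + r * (2 + \<delta>)" by (simp add: a_def)
    with 1 show ?case by (intro that[of C]) (simp_all only:)
  qed
  obtain D where D: "0 < D"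
    "\<And>n k. 1 \<le> k \<Longrightarrow> k \<le> n \<Longrightarrow>
       min 1 ((real k)\<^sup>2 * real n powr (- (\<delta> / (1 + a)))) \<le> D * real n powr (- (\<delta> / (real k + a)))"
    using square_powr_trade_off[OF assms(5) a] by blast
  show ?thesis
  \<comment> \<open>The factor 2 comes from \<open>tv_norm_diff_le\<close>. Neither C nor D depends
    on N or k, so one constant serves all k \<le> N.\<close>
  proof (intro exI[of _ "2 * (C * D)"] allI impI)
    fix N k :: nat assume k: "1 \<le> k \<and> k \<le> N"
    let ?e = "C * (D * real N powr (- (\<delta> / (real k + a))))"
    have "tv_norm_diff (marginal k (rescaled_power N f)) (tensor_power k f) \<le> ennreal (2 * ?e)"
    proof (rule tv_norm_diff_le)
      show "finite_measure (marginal k (rescaled_power N f))" "finite_measure (tensor_power k f)"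
        using prob_space_marginal_rescaled_power[OF assms(2)] prob_space_tensor_power[OF assms(2)] k
        by (auto intro: prob_space.finite_measure)
      show "sets (marginal k (rescaled_power N f)) = sets (tensor_power k f)"
        by (simp add: marginal_def sets_tensor_power)
      show "0 \<le> ?e" using C(1) D(1) by simp
      fix A assume "A \<in> sets (marginal k (rescaled_power N f))"
      then have "A \<in> sets (PiM {..<k} (\<lambda>_. borel))" by (simp add: marginal_def)
      then have "\<bar>measure (marginal k (rescaled_power N f)) A - measure (tensor_power k f) A\<bar>
         \<le> C * min 1 ((real k)\<^sup>2 * real N powr (- (\<delta> / (1 + a))))"
        using C(2) k by blast
      also have "\<dots> \<le> ?e" using D(2) k C(1) by (intro mult_left_mono) auto
      finally show "\<bar>measure (marginal k (rescaled_power N f)) A - measure (tensor_power k f) A\<bar> \<le> ?e" .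
    qed
    then show "tv_norm_diff (marginal k (rescaled_power N f)) (tensor_power k f)
             \<le> ennreal (2 * (C * D) * real N powr (- (\<delta> / (real k + 5 + \<delta> + r * (2 + \<delta>)))))"
      by (simp add: a_def mult.assoc add.assoc)
  qed
qed

end
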